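(* Let $N\ge 2$, $-2<\alpha<0$, $-1<\sigma<0$, and $\zeta(t)=t^\sigma$ for $t>0$. Assume that $p\ge 1+\frac{2+\alpha}{N-2(\sigma+1)}$, and set $$p_c=\frac{N(p-1)}{2+\alpha},\qquad \ell=\frac{Np_c}{N+2(\sigma+1)p_c}=\frac{N(p-1)}{2+\alpha+2(\sigma+1)(p-1)} .$$ Then there exists $\varepsilon_0>0$ such that for all $u_0\in L^{p_c}(\mathbb{R}^N)$ and $\mathbf{w}\in L^{\ell}(\mathbb{R}^N)$ with $\|u_0\|_{L^{p_c}}+\|\mathbf{w}\|_{L^\ell}<\varepsilon_0$, the integral equation $$u(t)=e^{t\Delta}u_0+\int_0^t e^{(t-\tau)\Delta}\left(|\cdot|^\alpha|u(\tau)|^p\right)d\tau+\int_0^t e^{(t-\tau)\Delta}\left(\zeta(\tau)\mathbf{w}\right)d\tau$$ admits a global-in-time solution $u$.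
   Context: $e^{t\Delta}$ is the heat semigroup on $\mathbb{R}^N$: $e^{t\Delta}\varphi=G_t\star\varphi$ for $t>0$, with $G_t(x)=(4\pi t)^{-N/2}e^{-|x|^2/(4t)}$. A global-in-time solution is a real-valued measurable function $u$ on $(0,\infty)\times\mathbb{R}^N$ for which the integral equation is meaningful and holds for every $t>0$ (for almost every $x\in\mathbb{R}^N$). *)

theory Defs
  imports "HOL-Analysis.Analysis"
begin

definition in_Lp :: "real \<Rightarrow> ('a::euclidean_space \<Rightarrow> real) \<Rightarrow> bool" where
  "in_Lp q f \<longleftrightarrow>
     f \<in> borel_measurable lebesgue \<and> integrable lebesgue (\<lambda>x. \<bar>f x\<bar> powr q)"

definition Lp_norm :: "real \<Rightarrow> ('a::euclidean_space \<Rightarrow> real) \<Rightarrow> real" where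
  "Lp_norm q f = (LINT x|lebesgue. \<bar>f x\<bar> powr q) powr (1 / q)"

definition heat_kernel :: "real \<Rightarrow> 'a::euclidean_space \<Rightarrow> real" where
  "heat_kernel t x =
     (4 * pi * t) powr (- (real DIM('a) / 2)) * exp (- (norm x)\<^sup>2 / (4 * t))"

definition heat :: "real \<Rightarrow> ('a::euclidean_space \<Rightarrow> real) \<Rightarrow> 'a \<Rightarrow> real" where
  "heat t f x = (LINT y|lebesgue. heat_kernel t (x - y) * f y)"

text \<open>Bochner integrals of non-integrable functions have the value 0. The two predicates
  ending in \<open>_converges\<close> therefore state separately that the integrals in \<open>heat\<close> and
  \<open>duhamel\<close> are absolutely convergent.\<close>

definition heat_converges :: "real \<Rightarrow> ('a::euclidean_space \<Rightarrow> real) \<Rightarrow> 'a \<Rightarrow> bool" where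
  "heat_converges t f x \<longleftrightarrow> integrable lebesgue (\<lambda>y. heat_kernel t (x - y) * f y)"

definition duhamel :: "(real \<Rightarrow> 'a::euclidean_space \<Rightarrow> real) \<Rightarrow> real \<Rightarrow> 'a \<Rightarrow> real" where
  "duhamel F t x = (LINT \<tau>:{0<..<t}|lebesgue. heat (t - \<tau>) (F \<tau>) x)"

definition duhamel_converges ::
    "(real \<Rightarrow> 'a::euclidean_space \<Rightarrow> real) \<Rightarrow> real \<Rightarrow> 'a \<Rightarrow> bool" where
  "duhamel_converges F t x \<longleftrightarrow>
     (AE \<tau> in lebesgue. \<tau> \<in> {0<..<t} \<longrightarrow> heat_converges (t - \<tau>) (F \<tau>) x) \<and>
     set_integrable lebesgue {0<..<t} (\<lambda>\<tau>. heat (t - \<tau>) (F \<tau>) x)"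

text \<open>The value of \<open>norm y powr \<alpha>\<close> at \<open>y = 0\<close> (which is 0) is irrelevant,
  since points are null sets. Values \<open>u t\<close> with \<open>t \<le> 0\<close> play no role.\<close>

definition nonlinearity ::
    "real \<Rightarrow> real \<Rightarrow> (real \<Rightarrow> 'a::euclidean_space \<Rightarrow> real) \<Rightarrow> real \<Rightarrow> 'a \<Rightarrow> real" where
  "nonlinearity \<alpha> p u \<tau> y = norm y powr \<alpha> * \<bar>u \<tau> y\<bar> powr p"

definition forcing ::
    "(real \<Rightarrow> real) \<Rightarrow> ('a::euclidean_space \<Rightarrow> real) \<Rightarrow> real \<Rightarrow> 'a \<Rightarrow> real" where
  "forcing \<zeta> w \<tau> y = \<zeta> \<tau> * w y"

definition global_solution ::
    "real \<Rightarrow> real \<Rightarrow> (real \<Rightarrow> real) \<Rightarrow> ('a::euclidean_space \<Rightarrow> real) \<Rightarrow> ('a \<Rightarrow> real)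
      \<Rightarrow> (real \<Rightarrow> 'a \<Rightarrow> real) \<Rightarrow> bool" where
  "global_solution \<alpha> p \<zeta> u0 w u \<longleftrightarrow>
     (\<lambda>(t, x). u t x) \<in> borel_measurable (lebesgue_on ({0<..} \<times> UNIV)) \<and>
     (\<forall>t>0. AE x in lebesgue.
        heat_converges t u0 x \<and>
        duhamel_converges (nonlinearity \<alpha> p u) t x \<and>
        duhamel_converges (forcing \<zeta> w) t x \<and>
        u t x = heat t u0 x + duhamel (nonlinearity \<alpha> p u) t x + duhamel (forcing \<zeta> w) t x)"

lemma ell_alternative_form:
  fixes N \<alpha> \<sigma> p pc :: real
  assumes "N > 0" "\<alpha> > -2" "pc = N * (p - 1) / (2 + \<alpha>)"
  shows "N * pc / (N + 2 * (\<sigma> + 1) * pc)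
       = N * (p - 1) / (2 + \<alpha> + 2 * (\<sigma> + 1) * (p - 1))"
proof -
  have a: "2 + \<alpha> \<noteq> 0" using assms by simp
  have "N + 2 * (\<sigma> + 1) * pc = N / (2 + \<alpha>) * (2 + \<alpha> + 2 * (\<sigma> + 1) * (p - 1))"
    using a unfolding assms(3) by (simp add: field_simps)
  moreover have "N * pc = N / (2 + \<alpha>) * (N * (p - 1))"
    unfolding assms(3) by simp
  moreover have "N / (2 + \<alpha>) \<noteq> 0" using a assms(1) by simp
  ultimately show ?thesis by simp
qed

end

theory Submission
  imports Defs "HOL-Probability.Probability"
begin

text \<open>For a suitable exponent \<open>q > p\<^sub>c\<close> and \<open>\<beta> = N/2 (1/p\<^sub>c - 1/q)\<close>, the heat semigroup
  smooths small data into functions with \<open>sup\<^sub>t t\<^sup>\<beta> \<parallel>f(t)\<parallel>\<^sub>q\<close> small, and the Duhamel operator of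
  \<open>|x|\<^sup>\<alpha> v\<^sup>p\<close> maps the ball of radius \<open>m\<close> of this scale-invariant norm into the ball of radius
  \<open>C m\<^sup>p\<close>. Hence the monotone iterates of the integral equation for the data \<open>|u\<^sub>0|\<close>, \<open>|w|\<close> stay
  bounded, and their limit \<open>V\<close>, with values in \<open>[0, \<infinity>]\<close>, is finite for almost every \<open>x\<close> at each
  time \<open>t > 0\<close>. Wherever \<open>V\<close> is finite, the increments of the Picard iterates for the signed data
  are dominated pointwise by those of the monotone iterates, so they converge there to a
  solution; no function space of solutions is needed.\<close>

section \<open>Powers of extended nonnegative reals and Jensen's inequality\<close>

text \<open>The equation is invariant under u(t, x) -> k^s u(k^2 t, k x), s = (2 + \<alpha>) / (p -
  1), when the data are rescaled accordingly. The norms of L^pc for the initial value, of L^l for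
  the forcing term, and the norm of \<open>decay_bound\<close> are invariant under this scaling. All
  constants are therefore uniform in time, and this is how smallness of the data yields global
  existence. Since N / l = s + 2 (\<sigma> + 1), the assumption on p says, for p > 1, exactly that l
  \<ge> 1. The equation must hold at every t > 0 for almost every x, so a statement almost
  everywhere on space-time would be too weak. Hence the norms are taken at each fixed time and the
  majorant equation is solved at every point, with values in [0, \<infinity>], where monotone
  convergence asks for no prior finiteness. The estimates concern Borel functions and
  \<open>lborel\<close>, where Tonelli's theorem applies on products; Lebesgue measurable data enter
  at the end through Borel representatives.\<close>

definition epowr :: "ennreal \<Rightarrow> real \<Rightarrow> ennreal" where
  "epowr x r = (if x = \<top> then \<top> else ennreal (enn2real x powr r))"

lemma epowr_top [simp]: "epowr \<top> r = \<top>"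
  by (simp add: epowr_def)

lemma epowr_0 [simp]: "epowr 0 r = 0"
  by (simp add: epowr_def)

lemma epowr_ennreal: "0 \<le> x \<Longrightarrow> epowr (ennreal x) r = ennreal (x powr r)"
  by (simp add: epowr_def)

lemma epowr_1 [simp]: "epowr x 1 = x"
  by (cases x) (auto simp: epowr_ennreal)

lemma epowr_eq_0_iff [simp]: "epowr x r = 0 \<longleftrightarrow> x = 0"
  by (cases x) (auto simp: epowr_ennreal powr_def)

lemma measurable_epowr [measurable (raw)]:
  "f \<in> borel_measurable M \<Longrightarrow> (\<lambda>x. epowr (f x) r) \<in> borel_measurable M"
proof -
  assume [measurable]: "f \<in> borel_measurable M"
  show ?thesis unfolding epowr_def by measurable
qed

lemma epowr_mono: "0 \<le> r \<Longrightarrow> x \<le> y \<Longrightarrow> epowr x r \<le> epowr y r"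
  by (cases x; cases y) (auto simp: epowr_ennreal powr_mono2 top_unique)

text \<open>Holds for every exponent because \<open>epowr\<close> fixes 0 and \<top> whatever r is,
  and 0 times \<top> is 0. The same convention makes \<open>epowr_epowr\<close> and
  \<open>epowr_add\<close> unconditional.\<close>

lemma epowr_mult: "epowr (x * y) r = epowr x r * epowr y r"
proof (cases "x = 0 \<or> y = 0")
  case False
  then show ?thesis
    by (cases x; cases y)
       (auto simp: epowr_ennreal ennreal_mult[symmetric] powr_mult ennreal_mult_top ennreal_top_mult)
qed auto

lemma epowr_epowr: "epowr (epowr x r) s = epowr x (r * s)"
  by (cases x) (auto simp: epowr_ennreal powr_powr)

lemma epowr_add: "epowr x (r + s) = epowr x r * epowr x s"
  by (cases x) (auto simp: epowr_ennreal powr_add ennreal_mult)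

text \<open>For r > 0 the power 1 / r is a monotone inverse, so the map is an order isomorphism and
  preserves suprema.\<close>

lemma epowr_SUP:
  fixes X :: "nat \<Rightarrow> ennreal"
  assumes "0 < r" "incseq X"
  shows "epowr (SUP n. X n) r = (SUP n. epowr (X n) r)"
proof (rule antisym)
  show "(SUP n. epowr (X n) r) \<le> epowr (SUP n. X n) r"
    using assms by (intro SUP_least epowr_mono SUP_upper) auto
  show "epowr (SUP n. X n) r \<le> (SUP n. epowr (X n) r)"
  proof -
    have "X n \<le> epowr (SUP n. epowr (X n) r) (1 / r)" for n
    proof -
      have "X n = epowr (epowr (X n) r) (1 / r)" using assms by (simp add: epowr_epowr)
      also have "\<dots> \<le> epowr (SUP n. epowr (X n) r) (1 / r)"
        using assms by (intro epowr_mono SUP_upper) auto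
      finally show ?thesis .
    qed
    then have "(SUP n. X n) \<le> epowr (SUP n. epowr (X n) r) (1 / r)" by (rule SUP_least)
    then have "epowr (SUP n. X n) r \<le> epowr (epowr (SUP n. epowr (X n) r) (1 / r)) r"
      using assms by (intro epowr_mono) auto
    then show ?thesis using assms by (simp add: epowr_epowr)
  qed
qed

text \<open>A sum of three is at most 3 times the maximum, and the power of the maximum is one of
  the three powers. The crude factor is absorbed in \<open>decay_bound_add3\<close>.\<close>

lemma epowr_add3_le:
  assumes "0 \<le> r"
  shows "epowr (a + b + c) r \<le> ennreal (3 powr r) * (epowr a r + epowr b r + epowr c r)"
proof -
  define m where "m = max a (max b c)"
  have "a + b + c \<le> m + m + m" unfolding m_def by (intro add_mono) (auto simp: le_max_iff_disj)
  also have "\<dots> = ennreal 3 * m"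
    by (cases m) (auto simp: ennreal_mult[symmetric] ennreal_mult_top
        simp flip: ennreal_plus simp del: ennreal_numeral)
  finally have "epowr (a + b + c) r \<le> epowr (ennreal 3 * m) r"
    using assms by (rule epowr_mono[rotated])
  also have "\<dots> = ennreal (3 powr r) * epowr m r"
    by (simp add: epowr_mult epowr_ennreal del: ennreal_numeral)
  also have "epowr m r \<le> epowr a r + epowr b r + epowr c r"
    unfolding m_def max_def by (auto intro: order_trans[OF _ add_increasing2] add_increasing add_increasing2)
  finally show ?thesis by (simp add: mult_left_mono)
qed

text \<open>The graph of x^r lies above its tangent at c; this is that inequality solved for x. It
  comes from Young's inequality for (x / c)^r and 1 with the weights 1 / r and 1 - 1 / r.\<close>

lemma powr_tangent:
  fixes x c r :: real
  assumes "1 \<le> r" "0 < c" "0 \<le> x"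
  shows "x \<le> c * (1 - 1 / r) + c powr (1 - r) * x powr r / r"
proof (cases "x = 0")
  case False
  then have x: "x > 0" using assms by simp
  have "x / c \<le> (1 - 1 / r) + (x / c) powr r / r"
    using Youngs_inequality_0[of "1 / r" "1 - 1 / r" "(x / c) powr r" 1] assms x
    by (simp add: powr_powr field_simps)
  then have "c * (x / c) \<le> c * ((1 - 1 / r) + (x / c) powr r / r)"
    using assms by (intro mult_left_mono) auto
  also have "c * ((1 - 1 / r) + (x / c) powr r / r) = c * (1 - 1 / r) + c powr (1 - r) * x powr r / r"
    using assms x by (simp add: powr_divide powr_diff distrib_left)
  finally show ?thesis using assms by simp
qed (use assms in auto)

text \<open>Integrating the affine bound of \<open>powr_tangent\<close> against k leaves only the
  choice of the point of tangency. The weights used later are the heat kernel, the heat kernel times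
  a power of the norm, and a majorant in time.\<close>

lemma nn_integral_Jensen:
  assumes r: "1 \<le> r" and [measurable]: "k \<in> borel_measurable M" "f \<in> borel_measurable M"
    and K: "0 < K" "(\<integral>\<^sup>+x. k x \<partial>M) \<le> ennreal K"
  shows "epowr (\<integral>\<^sup>+x. k x * f x \<partial>M) r
       \<le> ennreal (K powr (r - 1)) * (\<integral>\<^sup>+x. k x * epowr (f x) r \<partial>M)"
proof -
  define I where "I = (\<integral>\<^sup>+x. k x * epowr (f x) r \<partial>M)"
  consider "I = 0" | "I = \<top>" | a where "I = ennreal a" "a > 0"
    by (cases I) (metis ennreal_0 less_eq_real_def, blast)
  then show ?thesis
  proof cases
    case 1
    then have "AE x in M. k x * epowr (f x) r = 0"
      unfolding I_def by (subst (asm) nn_integral_0_iff_AE) auto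
    then have "AE x in M. k x * f x = 0" by eventually_elim auto
    then have "(\<integral>\<^sup>+x. k x * f x \<partial>M) = 0" by (subst nn_integral_0_iff_AE) auto
    then show ?thesis by simp
  next
    case 2
    then show ?thesis using K by (simp add: I_def[symmetric] ennreal_mult_top)
  next
    case (3 a)
    \<comment> \<open>With c^r K = a the two terms of the integrated bound add up to c K, whose r-th
      power is K^(r - 1) a.\<close>
    define c where "c = (a / K) powr (1 / r)"
    have c: "c > 0" using 3 K by (simp add: c_def)
    have pw: "k x * f x \<le> ennreal (c * (1 - 1 / r)) * k x
        + ennreal (c powr (1 - r) / r) * (k x * epowr (f x) r)" for x
    proof (cases "f x")
      case (real b)
      have "f x \<le> ennreal (c * (1 - 1 / r) + c powr (1 - r) * b powr r / r)"
        using powr_tangent[OF r c, of b] real by (simp add: ennreal_leI)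
      also have "\<dots> = ennreal (c * (1 - 1 / r)) + ennreal (c powr (1 - r) / r) * epowr (f x) r"
        using r c real by (subst ennreal_plus)
          (auto simp: epowr_ennreal ennreal_mult[symmetric] intro!: mult_nonneg_nonneg)
      finally have "k x * f x \<le> k x * \<dots>" by (rule mult_left_mono) simp
      then show ?thesis by (simp add: distrib_left mult_ac)
    next
      case top
      then show ?thesis using r c
        by (cases "k x = 0") (auto simp: ennreal_mult_top ennreal_top_mult)
    qed
    have "(\<integral>\<^sup>+x. k x * f x \<partial>M) \<le> (\<integral>\<^sup>+x. ennreal (c * (1 - 1 / r)) * k x
        + ennreal (c powr (1 - r) / r) * (k x * epowr (f x) r) \<partial>M)"
      by (intro nn_integral_mono pw)
    also have "\<dots> = ennreal (c * (1 - 1 / r)) * (\<integral>\<^sup>+x. k x \<partial>M) + ennreal (c powr (1 - r) / r) * I"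
      by (simp add: nn_integral_add nn_integral_cmult I_def)
    also have "\<dots> \<le> ennreal (c * (1 - 1 / r)) * ennreal K + ennreal (c powr (1 - r) / r) * ennreal a"
      using K 3 by (intro add_mono mult_left_mono) auto
    also have "\<dots> = ennreal (c * (1 - 1 / r) * K + c powr (1 - r) / r * a)"
      using r c K 3 by (simp add: ennreal_mult[symmetric] ennreal_plus[symmetric] del: ennreal_plus)
    also have "c * (1 - 1 / r) * K + c powr (1 - r) / r * a = c * K"
    proof -
      have "c powr r = a / K" using r K 3 by (simp add: c_def powr_powr)
      then have "a = c powr r * K" using K by simp
      then have "c powr (1 - r) / r * a = c powr (1 - r) * c powr r * K / r" by simp
      also have "c powr (1 - r) * c powr r = c" using c by (simp add: powr_add[symmetric])
      finally show ?thesis by (simp add: algebra_simps)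
    qed
    finally have "epowr (\<integral>\<^sup>+x. k x * f x \<partial>M) r \<le> epowr (ennreal (c * K)) r"
      using r by (intro epowr_mono) auto
    also have "\<dots> = ennreal (K powr (r - 1)) * I"
      using r K c 3
      by (simp add: epowr_ennreal ennreal_mult[symmetric] powr_mult c_def powr_powr powr_diff)
    finally show ?thesis by (simp add: I_def)
  qed
qed

section \<open>Smoothing estimates for the heat semigroup\<close>

lemma heat_kernel_nonneg [simp]: "0 \<le> heat_kernel t x"
  by (simp add: heat_kernel_def)

lemma measurable_heat_kernel [measurable (raw)]:
  fixes g :: "'b \<Rightarrow> 'a::euclidean_space"
  assumes [measurable]: "f \<in> borel_measurable M" "g \<in> borel_measurable M"
  shows "(\<lambda>z. heat_kernel (f z) (g z)) \<in> borel_measurable M"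
  unfolding heat_kernel_def by measurable

lemma heat_kernel_commute: "heat_kernel t (x - y) = heat_kernel t (y - x)"
  by (simp add: heat_kernel_def norm_minus_commute)

lemma heat_kernel_le:
  fixes x :: "'a::euclidean_space"
  assumes "0 < t"
  shows "heat_kernel t x \<le> (4 * pi * t) powr (- (real DIM('a) / 2))"
  using assms by (auto simp: heat_kernel_def intro!: mult_left_le)

text \<open>The factors are normal densities of variance 2 t centred at the coordinates of x. In
  this form \<open>nn_integral_lborel_prod\<close> reduces integrals over the space to integrals
  over the line.\<close>

lemma heat_kernel_eq_prod:
  fixes x y :: "'a::euclidean_space"
  assumes t: "0 < t"
  shows "heat_kernel t (x - y) = (\<Prod>b\<in>Basis. normal_density (x \<bullet> b) (sqrt (2 * t)) (y \<bullet> b))"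
proof -
  have "(\<Prod>b\<in>Basis. normal_density (x \<bullet> b) (sqrt (2 * t)) (y \<bullet> b))
     = (\<Prod>b\<in>(Basis::'a set). 1 / sqrt (4 * pi * t)) *
       (\<Prod>b\<in>Basis. exp (- (y \<bullet> b - x \<bullet> b)\<^sup>2 / (4 * t)))"
    unfolding prod.distrib[symmetric] using t by (intro prod.cong) (simp_all add: normal_density_def)
  also have "(\<Prod>b\<in>Basis. exp (- (y \<bullet> b - x \<bullet> b)\<^sup>2 / (4 * t))) = exp (- (norm (x - y))\<^sup>2 / (4 * t))"
  proof -
    have "(norm (x - y))\<^sup>2 = (\<Sum>b\<in>Basis. (y \<bullet> b - x \<bullet> b)\<^sup>2)"
      unfolding norm_minus_commute[of x y] power2_norm_eq_inner
      by (subst euclidean_inner) (simp add: inner_diff_left power2_eq_square)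
    then have "- (norm (x - y))\<^sup>2 / (4 * t) = (\<Sum>b\<in>Basis. - (y \<bullet> b - x \<bullet> b)\<^sup>2 / (4 * t))"
      by (simp add: sum_divide_distrib sum_negf)
    then show ?thesis by (simp only:) (rule exp_sum[OF finite_Basis, symmetric])
  qed
  also have "(\<Prod>b\<in>(Basis::'a set). 1 / sqrt (4 * pi * t)) = (4 * pi * t) powr (- (real DIM('a) / 2))"
  proof -
    have "1 / sqrt (4 * pi * t) = (4 * pi * t) powr (- (1 / 2))"
      using t by (simp add: powr_minus_divide powr_half_sqrt)
    then have "(\<Prod>b\<in>(Basis::'a set). 1 / sqrt (4 * pi * t))
       = ((4 * pi * t) powr (- (1 / 2))) powr real DIM('a)"
      using t by (simp add: powr_realpow)
    then show ?thesis by (simp add: powr_powr)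
  qed
  finally show ?thesis by (simp add: heat_kernel_def)
qed

lemma nn_integral_normal_density:
  assumes "0 < s" shows "(\<integral>\<^sup>+x. ennreal (normal_density m s x) \<partial>lborel) = 1"
  using prob_space.emeasure_space_1[OF prob_space_normal_density[OF assms, of m]]
  by (simp add: emeasure_density)

lemma nn_integral_heat_kernel:
  fixes x :: "'a::euclidean_space"
  assumes t: "0 < t"
  shows "(\<integral>\<^sup>+y. ennreal (heat_kernel t (x - y)) \<partial>lborel) = 1"
proof -
  have "(\<integral>\<^sup>+y. ennreal (heat_kernel t (x - y)) \<partial>lborel)
     = (\<integral>\<^sup>+y. (\<Prod>i\<in>Basis. ennreal (normal_density (x \<bullet> i) (sqrt (2 * t)) (y \<bullet> i))) \<partial>lborel)"
    using t by (simp add: heat_kernel_eq_prod prod_ennreal)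
  also have "\<dots> = (\<Prod>i\<in>Basis. \<integral>\<^sup>+y. ennreal (normal_density (x \<bullet> i) (sqrt (2 * t)) y) \<partial>lborel)"
    by (rule nn_integral_lborel_prod) auto
  finally show ?thesis using t by (simp add: nn_integral_normal_density)
qed

section \<open>Negative powers of the norm against the heat kernel\<close>

lemma nn_integral_powr_Icc:
  fixes c R :: real
  assumes "- 1 < c" "0 \<le> R"
  shows "(\<integral>\<^sup>+y. ennreal (y powr c) * indicator {0..R} y \<partial>lborel) = ennreal (R powr (c + 1) / (c + 1))"
proof -
  have "((\<lambda>y. if y \<in> {0..R} then y powr c else 0) has_integral (R powr (c + 1) / (c + 1))) UNIV"
    using has_integral_powr_from_0[OF assms] by (subst has_integral_restrict_UNIV)
  then have "(\<integral>\<^sup>+y. ennreal (if y \<in> {0..R} then y powr c else 0) \<partial>lborel)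
     = ennreal (R powr (c + 1) / (c + 1))"
    by (rule nn_integral_has_integral_lborel[rotated 2]) auto
  then show ?thesis
    by (simp add: indicator_def if_distrib of_bool_def mult.commute cong: if_cong)
qed

lemma nn_integral_abs_powr_Icc:
  fixes c R :: real
  assumes "- 1 < c" "0 \<le> R"
  shows "(\<integral>\<^sup>+y. ennreal (\<bar>y\<bar> powr c) * indicator {-R..R} y \<partial>lborel)
    \<le> ennreal (2 * R powr (c + 1) / (c + 1))"
proof -
  let ?f = "\<lambda>y. ennreal (y powr c) * indicator {0..R} y"
  have "(\<integral>\<^sup>+y. ennreal (\<bar>y\<bar> powr c) * indicator {-R..R} y \<partial>lborel)
     \<le> (\<integral>\<^sup>+y. ?f y + ?f (- y) \<partial>lborel)"
    by (intro nn_integral_mono) (auto simp: indicator_def abs_if)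
  also have "\<dots> = (\<integral>\<^sup>+y. ?f y \<partial>lborel) + (\<integral>\<^sup>+y. ?f (- y) \<partial>lborel)"
    by (intro nn_integral_add) auto
  also have "(\<integral>\<^sup>+y. ?f (- y) \<partial>lborel) = (\<integral>\<^sup>+y. ?f y \<partial>lborel)"
    using nn_integral_real_affine[of ?f "-1" 0] by simp
  finally show ?thesis
    using assms by (simp add: nn_integral_powr_Icc ennreal_plus[symmetric] del: ennreal_plus)
qed

text \<open>The factor is \<open>\<top>\<close> at the origin, so that a product over the coordinates dominates
  a power of the norm everywhere.\<close>

definition singular_powr :: "real \<Rightarrow> real \<Rightarrow> ennreal" where
  "singular_powr c y = (if y = 0 then \<top> else ennreal (\<bar>y\<bar> powr c))"

lemma measurable_singular_powr [measurable]: "singular_powr c \<in> borel_measurable borel"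
  unfolding singular_powr_def[abs_def] by measurable

text \<open>Split at the diffusive length |y| = sqrt t. Inside, the density is at most 1 / sqrt t
  and |y|^c is integrable because c > -1, which gives 2 / (c + 1); outside, |y|^c is at most t^(c /
  2) and the density has mass 1. Neither part depends on x.\<close>

lemma nn_integral_normal_density_singular_powr:
  assumes c: "- 1 < c" "c \<le> 0" and t: "0 < t"
  shows "(\<integral>\<^sup>+y. ennreal (normal_density x (sqrt (2 * t)) y) * singular_powr c y \<partial>lborel)
     \<le> ennreal ((2 / (c + 1) + 1) * t powr (c / 2))"
proof -
  let ?R = "sqrt t" and ?g = "normal_density x (sqrt (2 * t))"
  have g: "?g y \<le> 1 / ?R" for y
  proof -
    have "?g y \<le> 1 / sqrt (2 * pi * (sqrt (2 * t))\<^sup>2)"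
      unfolding normal_density_def by (intro mult_left_le) auto
    also have "\<dots> \<le> 1 / ?R" using t pi_gt3
      by (intro divide_left_mono) auto
    finally show ?thesis .
  qed
  have "(\<integral>\<^sup>+y. ennreal (?g y) * singular_powr c y \<partial>lborel) =
        (\<integral>\<^sup>+y. ennreal (?g y) * ennreal (\<bar>y\<bar> powr c) \<partial>lborel)"
    using AE_lborel_singleton[of "0::real"]
    by (intro nn_integral_cong_AE, eventually_elim) (simp add: singular_powr_def)
  also have "\<dots> \<le> (\<integral>\<^sup>+y. ennreal (1 / ?R) * (ennreal (\<bar>y\<bar> powr c) * indicator {-?R..?R} y)
      + ennreal (t powr (c / 2)) * ennreal (?g y) \<partial>lborel)"
  proof (intro nn_integral_mono)
    fix y
    show "ennreal (?g y) * ennreal (\<bar>y\<bar> powr c)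
      \<le> ennreal (1 / ?R) * (ennreal (\<bar>y\<bar> powr c) * indicator {-?R..?R} y)
      + ennreal (t powr (c / 2)) * ennreal (?g y)"
    proof (cases "y \<in> {-?R..?R}")
      case True
      have "ennreal (?g y) * ennreal (\<bar>y\<bar> powr c) \<le> ennreal (1 / ?R) * ennreal (\<bar>y\<bar> powr c)"
        using g by (intro mult_right_mono ennreal_leI) auto
      then show ?thesis using True by (simp add: add_increasing2)
    next
      case False
      then have "?R \<le> \<bar>y\<bar>" by auto
      then have "\<bar>y\<bar> powr c \<le> ?R powr c" using c t by (intro powr_mono2') auto
      also have "\<dots> = t powr (c / 2)" using t by (simp add: powr_half_sqrt[symmetric] powr_powr)
      finally have "ennreal (?g y) * ennreal (\<bar>y\<bar> powr c) \<le> ennreal (?g y) * ennreal (t powr (c / 2))"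
        by (intro mult_left_mono ennreal_leI) auto
      then show ?thesis by (simp add: add_increasing mult.commute)
    qed
  qed
  also have "\<dots> = ennreal (1 / ?R) * (\<integral>\<^sup>+y. ennreal (\<bar>y\<bar> powr c) * indicator {-?R..?R} y \<partial>lborel)
      + ennreal (t powr (c / 2)) * (\<integral>\<^sup>+y. ennreal (?g y) \<partial>lborel)"
    by (simp add: nn_integral_add nn_integral_cmult)
  also have "\<dots> \<le> ennreal (1 / ?R) * ennreal (2 * ?R powr (c + 1) / (c + 1)) + ennreal (t powr (c / 2)) * 1"
    using c t by (intro add_mono mult_left_mono nn_integral_abs_powr_Icc)
      (auto simp: nn_integral_normal_density)
  also have "\<dots> = ennreal (1 / ?R * (2 * ?R powr (c + 1) / (c + 1)) + t powr (c / 2))"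
    using c t by (simp add: ennreal_mult[symmetric] ennreal_plus[symmetric] del: ennreal_plus)
  also have "1 / ?R * (2 * ?R powr (c + 1) / (c + 1)) = 2 / (c + 1) * t powr (c / 2)"
    using c t by (simp add: powr_add powr_half_sqrt[symmetric] powr_powr)
  finally show ?thesis by (simp add: distrib_right)
qed

text \<open>Every coordinate is bounded by the norm and b \<le> 0, so the exponent can be shared
  equally among the coordinates. Local integrability, b > -N in dimension N, becomes the
  one-dimensional condition b / N > -1; this replaces polar coordinates.\<close>

lemma norm_powr_le_prod_singular_powr:
  fixes y :: "'a::euclidean_space"
  assumes "b \<le> 0"
  shows "ennreal (norm y powr b) \<le> (\<Prod>i\<in>Basis. singular_powr (b / DIM('a)) (y \<bullet> i))"
proof (cases "y = 0")
  case False
  have "norm y powr b = (\<Prod>i\<in>(Basis::'a set). norm y powr (b / DIM('a)))"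
    using False by (simp add: powr_realpow[symmetric] powr_powr)
  then have "ennreal (norm y powr b) = (\<Prod>i\<in>(Basis::'a set). ennreal (norm y powr (b / DIM('a))))"
    by (simp add: ennreal_power)
  also have "\<dots> \<le> (\<Prod>i\<in>Basis. singular_powr (b / DIM('a)) (y \<bullet> i))"
  proof (rule prod_mono_ennreal)
    fix i :: 'a assume i: "i \<in> Basis"
    show "ennreal (norm y powr (b / DIM('a))) \<le> singular_powr (b / DIM('a)) (y \<bullet> i)"
      using i assms by (auto simp: singular_powr_def Basis_le_norm divide_nonpos_nonneg
          intro!: ennreal_leI powr_mono2')
  qed
  finally show ?thesis .
qed simp

text \<open>Uniformity in x is the point: it makes this the mass bound of a Jensen weight in
  \<open>heat_nn_weighted_Lq\<close>. The power of t is the one dictated by scaling.\<close>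

lemma nn_integral_heat_kernel_norm_powr:
  fixes b :: real
  assumes b: "- real DIM('a::euclidean_space) < b" "b \<le> 0"
  shows "\<exists>C>0. \<forall>t>0. \<forall>x. (\<integral>\<^sup>+y. ennreal (heat_kernel t (x - y) * norm (y::'a) powr b) \<partial>lborel)
      \<le> ennreal (C * t powr (b / 2))"
proof -
  define c where "c = b / DIM('a)"
  have c: "- 1 < c" "c \<le> 0" using b DIM_positive[where 'a='a]
    by (auto simp: c_def field_simps divide_nonpos_nonneg)
  define C where "C = 2 / (c + 1) + 1"
  have C: "C > 0" using c by (simp add: C_def add_pos_pos)
  show ?thesis
  proof (intro exI[of _ "C ^ DIM('a)"] conjI allI impI)
    fix t :: real and x :: 'a assume t: "0 < t"
    let ?g = "\<lambda>i y. ennreal (normal_density (x \<bullet> i) (sqrt (2 * t)) y)"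
    have "(\<integral>\<^sup>+y. ennreal (heat_kernel t (x - y) * norm (y::'a) powr b) \<partial>lborel) \<le>
      (\<integral>\<^sup>+y. (\<Prod>i\<in>Basis. ?g i (y \<bullet> i) * singular_powr c (y \<bullet> i)) \<partial>lborel)"
    proof (rule nn_integral_mono)
      fix y :: 'a
      have "ennreal (heat_kernel t (x - y) * norm y powr b) =
          (\<Prod>i\<in>Basis. ?g i (y \<bullet> i)) * ennreal (norm y powr b)"
        by (subst ennreal_mult) (simp_all add: heat_kernel_eq_prod[OF t] prod_ennreal prod_nonneg)
      also have "\<dots> \<le> (\<Prod>i\<in>Basis. ?g i (y \<bullet> i)) * (\<Prod>i\<in>Basis. singular_powr c (y \<bullet> i))"
        unfolding c_def using b by (intro mult_left_mono norm_powr_le_prod_singular_powr) auto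
      finally show "ennreal (heat_kernel t (x - y) * norm y powr b) \<le>
         (\<Prod>i\<in>Basis. ?g i (y \<bullet> i) * singular_powr c (y \<bullet> i))"
        by (simp add: prod.distrib)
    qed
    also have "\<dots> = (\<Prod>i\<in>(Basis::'a set). \<integral>\<^sup>+y. ?g i y * singular_powr c y \<partial>lborel)"
      by (rule nn_integral_lborel_prod) auto
    also have "\<dots> \<le> (\<Prod>i\<in>(Basis::'a set). ennreal (C * t powr (c / 2)))"
      unfolding C_def using c t by (intro prod_mono_ennreal nn_integral_normal_density_singular_powr) auto
    also have "\<dots> = ennreal (C ^ DIM('a) * t powr (b / 2))"
      using C t by (simp add: ennreal_power c_def power_mult_distrib powr_realpow[symmetric] powr_powr)
    finally show "(\<integral>\<^sup>+y. ennreal (heat_kernel t (x - y) * norm (y::'a) powr b) \<partial>lborel)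
      \<le> ennreal (C ^ DIM('a) * t powr (b / 2))" .
  qed (use C in simp)
qed

section \<open>Smoothing of functions with values in [0, \<infinity>]\<close>

definition heat_nn :: "real \<Rightarrow> ('a::euclidean_space \<Rightarrow> ennreal) \<Rightarrow> 'a \<Rightarrow> ennreal" where
  "heat_nn t f x = (\<integral>\<^sup>+y. ennreal (heat_kernel t (x - y)) * f y \<partial>lborel)"

lemma measurable_heat_nn [measurable]:
  fixes f :: "'a::euclidean_space \<Rightarrow> ennreal"
  assumes [measurable]: "f \<in> borel_measurable borel"
  shows "heat_nn t f \<in> borel_measurable borel"
proof -
  have "(\<lambda>x. \<integral>\<^sup>+y. ennreal (heat_kernel t (x - y)) * f y \<partial>lborel) \<in> borel_measurable lborel"
    by measurable
  then show ?thesis unfolding heat_nn_def[abs_def] by simp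
qed

lemma nn_integral_heat_nn:
  fixes f :: "'a::euclidean_space \<Rightarrow> ennreal"
  assumes t: "0 < t" and [measurable]: "f \<in> borel_measurable borel"
  shows "(\<integral>\<^sup>+x. heat_nn t f x \<partial>lborel) = (\<integral>\<^sup>+x. f x \<partial>lborel)"
proof -
  have "(\<integral>\<^sup>+x. heat_nn t f x \<partial>lborel)
     = (\<integral>\<^sup>+y. \<integral>\<^sup>+x. ennreal (heat_kernel t (x - y)) * f y \<partial>lborel \<partial>lborel)"
    unfolding heat_nn_def by (rule lborel_pair.Fubini') measurable
  also have "\<dots> = (\<integral>\<^sup>+y. f y * (\<integral>\<^sup>+x. ennreal (heat_kernel t (y - x)) \<partial>lborel) \<partial>lborel)"
    by (subst heat_kernel_commute, subst mult.commute, intro nn_integral_cong nn_integral_cmult)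
      measurable
  finally show ?thesis by (simp add: nn_integral_heat_kernel[OF t])
qed

lemma heat_nn_le:
  fixes f :: "'a::euclidean_space \<Rightarrow> ennreal"
  assumes t: "0 < t" and [measurable]: "f \<in> borel_measurable borel"
  shows "heat_nn t f x \<le> ennreal ((4 * pi * t) powr (- (real DIM('a) / 2))) * (\<integral>\<^sup>+y. f y \<partial>lborel)"
  unfolding heat_nn_def using t
  by (subst nn_integral_cmult[symmetric])
     (auto intro!: nn_integral_mono mult_right_mono ennreal_leI heat_kernel_le)

text \<open>Interpolation between L^1 and the sup bound: of the s-th power, the power s - 1 is
  estimated by \<open>heat_nn_le\<close>, and the remaining factor is integrated exactly by
  conservation of mass.\<close>

lemma nn_integral_epowr_heat_nn:
  fixes f :: "'a::euclidean_space \<Rightarrow> ennreal"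
  assumes t: "0 < t" and s: "1 \<le> s" and [measurable]: "f \<in> borel_measurable borel"
  shows "(\<integral>\<^sup>+x. epowr (heat_nn t f x) s \<partial>lborel)
    \<le> ennreal ((4 * pi * t) powr (- (real DIM('a) / 2 * (s - 1)))) * epowr (\<integral>\<^sup>+y. f y \<partial>lborel) s"
proof -
  let ?c = "ennreal ((4 * pi * t) powr (- (real DIM('a) / 2)))" and ?I = "\<integral>\<^sup>+y. f y \<partial>lborel"
  have "(\<integral>\<^sup>+x. epowr (heat_nn t f x) s \<partial>lborel)
     = (\<integral>\<^sup>+x. epowr (heat_nn t f x) (s - 1) * heat_nn t f x \<partial>lborel)"
    using epowr_add[of _ "s - 1" 1] by simp
  also have "\<dots> \<le> (\<integral>\<^sup>+x. epowr (?c * ?I) (s - 1) * heat_nn t f x \<partial>lborel)"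
    using s t by (intro nn_integral_mono mult_right_mono epowr_mono heat_nn_le) auto
  also have "\<dots> = epowr ?c (s - 1) * (epowr ?I (s - 1) * ?I)"
    using t by (simp add: nn_integral_cmult nn_integral_heat_nn epowr_mult mult.assoc)
  also have "epowr ?I (s - 1) * ?I = epowr ?I s"
    using epowr_add[of _ "s - 1" 1] by simp
  also have "epowr ?c (s - 1) = ennreal ((4 * pi * t) powr (- (real DIM('a) / 2 * (s - 1))))"
    by (simp add: epowr_ennreal powr_powr)
  finally show ?thesis .
qed

lemma epowr_heat_nn_le:
  fixes f :: "'a::euclidean_space \<Rightarrow> ennreal"
  assumes t: "0 < t" and r: "1 \<le> r" and [measurable]: "f \<in> borel_measurable borel"
  shows "epowr (heat_nn t f x) r \<le> heat_nn t (\<lambda>y. epowr (f y) r) x"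
  unfolding heat_nn_def
  using nn_integral_Jensen[OF r, of "\<lambda>y. ennreal (heat_kernel t (x - y))" lborel f 1]
  by (simp add: nn_integral_heat_kernel[OF t])

text \<open>Jensen's inequality moves the r-th power inside the semigroup, so the estimate from L^r
  to L^q reduces to the one from L^1 to L^(q / r), applied to f^r.\<close>

lemma heat_nn_Lp_Lq:
  fixes f :: "'a::euclidean_space \<Rightarrow> ennreal"
  assumes t: "0 < t" and r: "1 \<le> r" "r \<le> q" and [measurable]: "f \<in> borel_measurable borel"
  shows "(\<integral>\<^sup>+x. epowr (heat_nn t f x) q \<partial>lborel)
    \<le> ennreal ((4 * pi * t) powr (- (real DIM('a) / 2 * (q / r - 1))))
       * epowr (\<integral>\<^sup>+y. epowr (f y) r \<partial>lborel) (q / r)"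
proof -
  have "(\<integral>\<^sup>+x. epowr (heat_nn t f x) q \<partial>lborel)
     = (\<integral>\<^sup>+x. epowr (epowr (heat_nn t f x) r) (q / r) \<partial>lborel)"
    using r by (simp add: epowr_epowr)
  also have "\<dots> \<le> (\<integral>\<^sup>+x. epowr (heat_nn t (\<lambda>y. epowr (f y) r) x) (q / r) \<partial>lborel)"
    using r by (intro nn_integral_mono epowr_mono epowr_heat_nn_le t) auto
  also have "\<dots> \<le> ennreal ((4 * pi * t) powr (- (real DIM('a) / 2 * (q / r - 1))))
       * epowr (\<integral>\<^sup>+y. epowr (f y) r \<partial>lborel) (q / r)"
    using r by (intro nn_integral_epowr_heat_nn t) auto
  finally show ?thesis .
qed

text \<open>By Jensen's inequality with the weight \<open>G\<^sub>t(x - y) |y|\<^sup>b\<close>, where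
  \<open>b = \<alpha> q / (q - p)\<close> is \<open>\<alpha>\<close> times the exponent conjugate to \<open>q / p\<close>.\<close>

lemma heat_nn_weighted_Lq:
  fixes \<alpha> p q :: real
  assumes \<alpha>: "\<alpha> \<le> 0" and p: "1 < p" "p < q" and q: "DIM('a) * p < q * (DIM('a) + \<alpha>)"
  shows "\<exists>C>0. \<forall>t>0. \<forall>v :: 'a::euclidean_space \<Rightarrow> ennreal. v \<in> borel_measurable borel \<longrightarrow>
      (\<integral>\<^sup>+x. epowr (heat_nn t (\<lambda>y. ennreal (norm y powr \<alpha>) * epowr (v y) p) x) q \<partial>lborel)
      \<le> ennreal (C * t powr (\<alpha> * q / 2 - DIM('a) / 2 * (p - 1)))
         * epowr (\<integral>\<^sup>+x. epowr (v x) q \<partial>lborel) p"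
proof -
  define r where "r = q / p"
  define b where "b = \<alpha> * r / (r - 1)"
  have r: "1 < r" using p by (simp add: r_def)
  have b_eq: "b = \<alpha> * q / (q - p)" using p by (simp add: b_def r_def divide_simps)
  \<comment> \<open>The lower bound is the assumption \<open>q\<close> rewritten: it makes |y|^b
    locally integrable.\<close>
  have b: "- real DIM('a) < b" "b \<le> 0"
    using \<alpha> p q by (simp_all add: b_eq field_simps mult_le_0_iff)
  obtain C where C: "0 < C" "\<forall>t>0. \<forall>x.
      (\<integral>\<^sup>+y. ennreal (heat_kernel t (x - y) * norm (y::'a) powr b) \<partial>lborel) \<le> ennreal (C * t powr (b / 2))"
    using nn_integral_heat_kernel_norm_powr[OF b] by auto
  \<comment> \<open>The first factor is the Jensen constant, since (r - 1) p = q - p; the second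
    comes from smoothing v^q from L^1 to L^p.\<close>
  define D where "D = C powr (q - p) * (4 * pi) powr (- (DIM('a) / 2 * (p - 1)))"
  show ?thesis
  proof (intro exI[of _ D] conjI allI impI)
    fix t :: real and v :: "'a \<Rightarrow> ennreal"
    assume t: "0 < t" and [measurable]: "v \<in> borel_measurable borel"
    let ?h = "heat_nn t (\<lambda>y. ennreal (norm y powr \<alpha>) * epowr (v y) p)"
    let ?g = "heat_nn t (\<lambda>y. epowr (v y) q)"
    have pw: "epowr (?h x) r \<le> ennreal ((C * t powr (b / 2)) powr (r - 1)) * ?g x" for x
    proof -
      let ?k = "\<lambda>y. ennreal (heat_kernel t (x - y) * norm y powr b)"
      \<comment> \<open>The weight takes |y|^b out of |y|^\<alpha>. By the choice of b, b +
        (\<alpha> - b) r = 0, so after Jensen's inequality all powers of the norm cancel and the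
        semigroup acting on v^q remains.\<close>
      let ?f = "\<lambda>y. epowr (v y) p * ennreal (norm y powr (\<alpha> - b))"
      have eq: "(\<integral>\<^sup>+y. ?k y * ?f y \<partial>lborel) = ?h x"
        unfolding heat_nn_def
      proof (rule nn_integral_cong)
        fix y :: 'a
        have "norm y powr \<alpha> = norm y powr b * norm y powr (\<alpha> - b)"
          by (simp add: powr_add[symmetric])
        then show "?k y * ?f y
            = ennreal (heat_kernel t (x - y)) * (ennreal (norm y powr \<alpha>) * epowr (v y) p)"
          by (simp add: ennreal_mult mult_ac)
      qed
      have le: "(\<integral>\<^sup>+y. ?k y * epowr (?f y) r \<partial>lborel) \<le> ?g x"
        unfolding heat_nn_def
      proof (rule nn_integral_mono)
        fix y :: 'a
        \<comment> \<open>Equality fails only at y = 0, where \<open>powr\<close> has the value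
          0.\<close>
        have e: "norm y powr b * norm y powr ((\<alpha> - b) * r) \<le> 1"
        proof -
          have "b + (\<alpha> - b) * r = 0" using r by (simp add: b_def field_simps)
          then show ?thesis by (simp add: powr_add[symmetric])
        qed
        have "?k y * epowr (?f y) r = ennreal (heat_kernel t (x - y)) * epowr (v y) q
           * ennreal (norm y powr b * norm y powr ((\<alpha> - b) * r))"
          using p by (simp add: epowr_mult epowr_epowr epowr_ennreal powr_powr r_def ennreal_mult mult_ac)
        also have "\<dots> \<le> ennreal (heat_kernel t (x - y)) * epowr (v y) q * 1"
          using ennreal_leI[OF e] by (intro mult_left_mono) auto
        finally show "?k y * epowr (?f y) r \<le> ennreal (heat_kernel t (x - y)) * epowr (v y) q"
          by simp
      qed
      have "epowr (?h x) r \<le> ennreal ((C * t powr (b / 2)) powr (r - 1))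
          * (\<integral>\<^sup>+y. ?k y * epowr (?f y) r \<partial>lborel)"
        unfolding eq[symmetric]
      proof (rule nn_integral_Jensen)
        show "0 < C * t powr (b / 2)" using C t by simp
        show "(\<integral>\<^sup>+y. ?k y \<partial>lborel) \<le> ennreal (C * t powr (b / 2))" using C(2) t by blast
      qed (use r in auto)
      also have "\<dots> \<le> ennreal ((C * t powr (b / 2)) powr (r - 1)) * ?g x"
        by (intro mult_left_mono le) simp
      finally show ?thesis .
    qed
    have "(\<integral>\<^sup>+x. epowr (?h x) q \<partial>lborel) = (\<integral>\<^sup>+x. epowr (epowr (?h x) r) p \<partial>lborel)"
      using p by (simp add: epowr_epowr r_def)
    also have "\<dots> \<le> (\<integral>\<^sup>+x. epowr (ennreal ((C * t powr (b / 2)) powr (r - 1)) * ?g x) p \<partial>lborel)"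
      using p by (intro nn_integral_mono epowr_mono pw) auto
    also have "\<dots> = ennreal ((C * t powr (b / 2)) powr ((r - 1) * p)) * (\<integral>\<^sup>+x. epowr (?g x) p \<partial>lborel)"
      by (simp add: epowr_mult nn_integral_cmult epowr_ennreal powr_powr)
    also have "\<dots> \<le> ennreal ((C * t powr (b / 2)) powr ((r - 1) * p)) *
        (ennreal ((4 * pi * t) powr (- (real DIM('a) / 2 * (p - 1))))
         * epowr (\<integral>\<^sup>+x. epowr (v x) q \<partial>lborel) p)"
      using p t by (intro mult_left_mono nn_integral_epowr_heat_nn) auto
    also have "(r - 1) * p = q - p" using p by (simp add: r_def field_simps)
    also have "(C * t powr (b / 2)) powr (q - p) = C powr (q - p) * t powr (\<alpha> * q / 2)"
    proof -
      have "b * (q - p) = \<alpha> * q" using p by (simp add: b_eq)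
      then have "b / 2 * (q - p) = \<alpha> * q / 2" by simp
      then show ?thesis using C(1) t by (simp add: powr_mult powr_powr)
    qed
    also have "(4 * pi * t) powr (- (real DIM('a) / 2 * (p - 1)))
        = (4 * pi) powr (- (DIM('a) / 2 * (p - 1))) * t powr (- (DIM('a) / 2 * (p - 1)))"
      using t by (simp add: powr_mult)
    also have "ennreal (C powr (q - p) * t powr (\<alpha> * q / 2)) *
        (ennreal ((4 * pi) powr (- (DIM('a) / 2 * (p - 1))) * t powr (- (DIM('a) / 2 * (p - 1))))
         * epowr (\<integral>\<^sup>+x. epowr (v x) q \<partial>lborel) p)
       = ennreal (D * (t powr (\<alpha> * q / 2) * t powr (- (DIM('a) / 2 * (p - 1)))))
         * epowr (\<integral>\<^sup>+x. epowr (v x) q \<partial>lborel) p"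
      by (subst mult.assoc[symmetric], subst ennreal_mult[symmetric]) (auto simp: D_def mult.assoc mult.left_commute)
    also have "t powr (\<alpha> * q / 2) * t powr (- (DIM('a) / 2 * (p - 1)))
       = t powr (\<alpha> * q / 2 - DIM('a) / 2 * (p - 1))"
      by (simp add: powr_add[symmetric])
    finally show "(\<integral>\<^sup>+x. epowr (?h x) q \<partial>lborel)
      \<le> ennreal (D * t powr (\<alpha> * q / 2 - DIM('a) / 2 * (p - 1)))
         * epowr (\<integral>\<^sup>+x. epowr (v x) q \<partial>lborel) p" .
  qed (use C in \<open>simp add: D_def\<close>)
qed

section \<open>The Duhamel operator in scale-invariant norms\<close>

text \<open>Minkowski's integral inequality, in the case of a known majorant \<open>k\<close> of the norms:
  Jensen's inequality for the weight \<open>k\<close> then suffices.\<close>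

lemma nn_integral_Minkowski:
  fixes F :: "'b \<times> 'c \<Rightarrow> ennreal" and k :: "'b \<Rightarrow> real"
  assumes "sigma_finite_measure M" "sigma_finite_measure N"
    and [measurable]: "F \<in> borel_measurable (M \<Otimes>\<^sub>M N)" "A \<in> sets M" "k \<in> borel_measurable M"
    and q: "1 \<le> q" and m: "0 \<le> m" and K: "0 < K"
    and k: "\<And>s. s \<in> A \<Longrightarrow> 0 < k s"
    and F: "\<And>s. s \<in> A \<Longrightarrow> (\<integral>\<^sup>+x. epowr (F (s, x)) q \<partial>N) \<le> ennreal ((m * k s) powr q)"
    and kK: "(\<integral>\<^sup>+s. indicator A s * ennreal (k s) \<partial>M) \<le> ennreal K"
  shows "(\<integral>\<^sup>+x. epowr (\<integral>\<^sup>+s. indicator A s * F (s, x) \<partial>M) q \<partial>N) \<le> ennreal ((m * K) powr q)"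
proof -
  interpret pair_sigma_finite M N using assms(1,2) by (simp add: pair_sigma_finite_def)
  let ?w = "\<lambda>s. indicator A s * ennreal (k s)"
  \<comment> \<open>Writing F as k times F / k makes k the weight. Jensen's inequality leaves k^(1 -
    q) F^q, whose integral over x is at most m^q k by assumption.\<close>
  let ?f = "\<lambda>s x. ennreal (1 / k s) * F (s, x)"
  have pw: "epowr (\<integral>\<^sup>+s. indicator A s * F (s, x) \<partial>M) q
      \<le> ennreal (K powr (q - 1)) * (\<integral>\<^sup>+s. ?w s * epowr (?f s x) q \<partial>M)" if [simp]: "x \<in> space N" for x
  proof -
    have "(\<integral>\<^sup>+s. indicator A s * F (s, x) \<partial>M) = (\<integral>\<^sup>+s. ?w s * ?f s x \<partial>M)"
    proof (rule nn_integral_cong)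
      fix s
      have "ennreal (k s) * ennreal (1 / k s) = 1" if "s \<in> A"
        using k[OF that] by (simp add: ennreal_mult[symmetric])
      then have "ennreal (k s) * (ennreal (1 / k s) * F (s, x)) = F (s, x)" if "s \<in> A"
        using that by (simp add: mult.assoc[symmetric])
      then show "indicator A s * F (s, x) = ?w s * ?f s x"
        by (simp add: indicator_def)
    qed
    then show ?thesis using nn_integral_Jensen[OF q _ _ K kK, of "\<lambda>s. ?f s x"] by simp
  qed
  have "(\<integral>\<^sup>+x. epowr (\<integral>\<^sup>+s. indicator A s * F (s, x) \<partial>M) q \<partial>N)
     \<le> (\<integral>\<^sup>+x. ennreal (K powr (q - 1)) * (\<integral>\<^sup>+s. ?w s * epowr (?f s x) q \<partial>M) \<partial>N)"
    by (intro nn_integral_mono pw)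
  also have "\<dots> = ennreal (K powr (q - 1)) * (\<integral>\<^sup>+x. (\<integral>\<^sup>+s. ?w s * epowr (?f s x) q \<partial>M) \<partial>N)"
    by (rule nn_integral_cmult) measurable
  also have "(\<integral>\<^sup>+x. (\<integral>\<^sup>+s. ?w s * epowr (?f s x) q \<partial>M) \<partial>N)
      = (\<integral>\<^sup>+s. (\<integral>\<^sup>+x. ?w s * epowr (?f s x) q \<partial>N) \<partial>M)"
    by (rule Fubini') measurable
  also have "\<dots> \<le> (\<integral>\<^sup>+s. ennreal (m powr q) * ?w s \<partial>M)"
  proof (rule nn_integral_mono)
    fix s assume s: "s \<in> space M"
    show "(\<integral>\<^sup>+x. ?w s * epowr (?f s x) q \<partial>N) \<le> ennreal (m powr q) * ?w s"
    proof (cases "s \<in> A")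
      case True
      have "(\<integral>\<^sup>+x. ?w s * epowr (?f s x) q \<partial>N)
         = (\<integral>\<^sup>+x. (ennreal (k s) * epowr (ennreal (1 / k s)) q) * epowr (F (s, x)) q \<partial>N)"
        using True by (simp add: epowr_mult mult.assoc)
      also have "\<dots> = (ennreal (k s) * epowr (ennreal (1 / k s)) q) * (\<integral>\<^sup>+x. epowr (F (s, x)) q \<partial>N)"
        using s by (intro nn_integral_cmult) measurable
      also have "\<dots> \<le> (ennreal (k s) * epowr (ennreal (1 / k s)) q) * ennreal ((m * k s) powr q)"
        by (intro mult_left_mono F True) simp
      also have "\<dots> = ennreal (k s * (1 / k s) powr q * (m * k s) powr q)"
        using k[OF True] by (simp add: epowr_ennreal ennreal_mult)
      also have "k s * (1 / k s) powr q * (m * k s) powr q = m powr q * k s"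
        using k[OF True] m by (simp add: powr_mult powr_divide)
      finally show ?thesis using True k[OF True] by (simp add: ennreal_mult)
    qed simp
  qed
  also have "\<dots> = ennreal (m powr q) * (\<integral>\<^sup>+s. ?w s \<partial>M)"
    by (rule nn_integral_cmult) measurable
  also have "ennreal (K powr (q - 1)) * \<dots> \<le> ennreal (K powr (q - 1)) * (ennreal (m powr q) * ennreal K)"
    by (intro mult_left_mono kK) auto
  also have "\<dots> = ennreal ((m * K) powr q)"
    using K m by (simp add: ennreal_mult[symmetric] powr_mult powr_diff)
  finally show ?thesis by (simp add: mult_left_mono)
qed

text \<open>A bound for the Beta integral: at each s one of s and t - s is at least t / 2, so one
  factor is bounded by its value at t / 2 and the other is integrated. The two cases give the two
  summands of C.\<close>

lemma nn_integral_time_weight: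
  fixes a b :: real
  assumes a: "0 \<le> a" "a < 1" and b: "0 \<le> b" "b < 1"
  shows "\<exists>C>0. \<forall>t>0. (\<integral>\<^sup>+s. indicator {0<..<t} s * ennreal ((t - s) powr (- a) * s powr (- b)) \<partial>lborel)
    \<le> ennreal (C * t powr (1 - a - b))"
proof -
  define C where "C = (1 / 2) powr (- a) / (1 - b) + (1 / 2) powr (- b) / (1 - a)"
  have C: "C > 0" using a b by (simp add: C_def add_pos_pos)
  show ?thesis
  proof (intro exI[of _ C] conjI allI impI C)
    fix t :: real assume t: "0 < t"
    let ?f = "\<lambda>c s. ennreal (s powr (- c)) * indicator {0..t} s"
    let ?A = "ennreal ((t / 2) powr (- a))" and ?B = "ennreal ((t / 2) powr (- b))"
    have pw: "indicator {0<..<t} s * ennreal ((t - s) powr (- a) * s powr (- b))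
      \<le> ?A * ?f b s + ?B * ?f a (t - s)" for s
    proof (cases "s \<in> {0<..<t}")
      case True
      consider "t / 2 \<le> t - s" | "t / 2 \<le> s" by linarith
      then have "(t - s) powr (- a) * s powr (- b)
         \<le> (t / 2) powr (- a) * s powr (- b) + (t / 2) powr (- b) * (t - s) powr (- a)"
      proof cases
        case 1
        then have "(t - s) powr (- a) \<le> (t / 2) powr (- a)" using t a by (intro powr_mono2') auto
        then have "(t - s) powr (- a) * s powr (- b) \<le> (t / 2) powr (- a) * s powr (- b)"
          by (rule mult_right_mono) simp
        then show ?thesis by (simp add: add_increasing2)
      next
        case 2
        then have "s powr (- b) \<le> (t / 2) powr (- b)" using t b by (intro powr_mono2') auto
        then have "s powr (- b) * (t - s) powr (- a) \<le> (t / 2) powr (- b) * (t - s) powr (- a)"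
          by (rule mult_right_mono) simp
        then show ?thesis by (simp add: add_increasing mult.commute)
      qed
      then have "ennreal ((t - s) powr (- a) * s powr (- b)) \<le> ennreal \<dots>" by (rule ennreal_leI)
      also have "\<dots> = ?A * ?f b s + ?B * ?f a (t - s)"
        using True by (simp add: ennreal_mult)
      finally show ?thesis using True by simp
    qed simp
    have "(\<integral>\<^sup>+s. indicator {0<..<t} s * ennreal ((t - s) powr (- a) * s powr (- b)) \<partial>lborel)
       \<le> (\<integral>\<^sup>+s. ?A * ?f b s + ?B * ?f a (t - s) \<partial>lborel)"
      by (intro nn_integral_mono pw)
    also have "\<dots> = ?A * (\<integral>\<^sup>+s. ?f b s \<partial>lborel) + ?B * (\<integral>\<^sup>+s. ?f a (t - s) \<partial>lborel)"
      by (simp add: nn_integral_add nn_integral_cmult)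
    also have "(\<integral>\<^sup>+s. ?f a (t - s) \<partial>lborel) = (\<integral>\<^sup>+s. ?f a s \<partial>lborel)"
      using nn_integral_real_affine[of "?f a" "-1" t] by simp
    also have "?A * (\<integral>\<^sup>+s. ?f b s \<partial>lborel) + ?B * (\<integral>\<^sup>+s. ?f a s \<partial>lborel)
       = ennreal ((t / 2) powr (- a) * (t powr (1 - b) / (1 - b)) + (t / 2) powr (- b) * (t powr (1 - a) / (1 - a)))"
      using nn_integral_powr_Icc[of "- b" t] nn_integral_powr_Icc[of "- a" t] a b t
      by (simp add: ennreal_mult[symmetric] ennreal_plus[symmetric] del: ennreal_plus)
    also have "(t / 2) powr (- a) * (t powr (1 - b) / (1 - b)) + (t / 2) powr (- b) * (t powr (1 - a) / (1 - a))
       = C * t powr (1 - a - b)"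
    proof -
      have "(t / 2) powr (- c) * t powr (1 - d) = (1 / 2) powr (- c) * t powr (1 - c - d)" for c d
      proof -
        have "(t / 2) powr (- c) = (1 / 2) powr (- c) * t powr (- c)"
          using t by (simp add: powr_mult[symmetric])
        moreover have "t powr (- c) * t powr (1 - d) = t powr (1 - c - d)"
          by (simp add: powr_add[symmetric] algebra_simps)
        ultimately show ?thesis by simp
      qed
      from this[of a b] this[of b a] show ?thesis
        by (simp add: C_def distrib_right add.commute diff_diff_eq)
    qed
    finally show "(\<integral>\<^sup>+s. indicator {0<..<t} s * ennreal ((t - s) powr (- a) * s powr (- b)) \<partial>lborel)
      \<le> ennreal (C * t powr (1 - a - b))" .
  qed
qed

text \<open>With the constraint 0 < s < t built in, the Duhamel term is a single integral operator
  over space-time. Monotone convergence is then applied once, and \<open>majorant_principle\<close>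
  can treat it as an abstract nonnegative kernel.\<close>

definition duhamel_kernel :: "real \<times> 'a::euclidean_space \<Rightarrow> real \<times> 'a \<Rightarrow> real" where
  "duhamel_kernel z z' =
    (if 0 < fst z' \<and> fst z' < fst z then heat_kernel (fst z - fst z') (snd z - snd z') else 0)"

lemma duhamel_kernel_nonneg [simp]: "0 \<le> duhamel_kernel z z'"
  by (simp add: duhamel_kernel_def)

lemma measurable_duhamel_kernel [measurable (raw)]:
  fixes f g :: "'b \<Rightarrow> real \<times> 'a::euclidean_space"
  assumes [measurable]: "f \<in> borel_measurable M" "g \<in> borel_measurable M"
  shows "(\<lambda>z. duhamel_kernel (f z) (g z)) \<in> borel_measurable M"
proof -
  have [measurable]: "(\<lambda>z. fst (h z)) \<in> borel_measurable M" "(\<lambda>z. snd (h z)) \<in> borel_measurable M"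
    if [measurable]: "h \<in> borel_measurable M" for h :: "'b \<Rightarrow> real \<times> 'a"
  proof -
    have "fst \<in> borel_measurable (borel :: (real \<times> 'a) measure)"
      "snd \<in> borel_measurable (borel :: (real \<times> 'a) measure)"
      unfolding borel_prod[symmetric] by measurable
    then show "(\<lambda>z. fst (h z)) \<in> borel_measurable M" "(\<lambda>z. snd (h z)) \<in> borel_measurable M"
      by measurable
  qed
  show ?thesis unfolding duhamel_kernel_def by measurable
qed

definition duhamel_nn :: "(real \<times> 'a::euclidean_space \<Rightarrow> ennreal) \<Rightarrow> real \<times> 'a \<Rightarrow> ennreal" where
  "duhamel_nn F z = (\<integral>\<^sup>+z'. ennreal (duhamel_kernel z z') * F z' \<partial>lborel)"

lemma measurable_duhamel_nn [measurable (raw)]: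
  fixes F :: "real \<times> 'a::euclidean_space \<Rightarrow> ennreal"
  assumes [measurable]: "F \<in> borel_measurable borel"
  shows "duhamel_nn F \<in> borel_measurable borel"
proof -
  have "(\<lambda>z. \<integral>\<^sup>+z'. ennreal (duhamel_kernel z z') * F z' \<partial>lborel) \<in> borel_measurable lborel"
    by measurable
  then show ?thesis unfolding duhamel_nn_def[abs_def] by simp
qed

lemma measurable_lborel_pair:
  fixes F :: "'a::euclidean_space \<times> 'b::euclidean_space \<Rightarrow> 'c::topological_space"
  shows "F \<in> borel_measurable borel \<Longrightarrow> F \<in> borel_measurable (lborel \<Otimes>\<^sub>M lborel)"
  by (simp add: lborel_prod)

lemma duhamel_nn_iterated:
  fixes F :: "real \<times> 'a::euclidean_space \<Rightarrow> ennreal"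
  assumes [measurable]: "F \<in> borel_measurable borel"
  shows "duhamel_nn F (t, x)
    = (\<integral>\<^sup>+s. indicator {0<..<t} s * heat_nn (t - s) (\<lambda>y. F (s, y)) x \<partial>lborel)"
proof -
  have [measurable]: "(\<lambda>z'. ennreal (duhamel_kernel (t, x) z') * F z') \<in> borel_measurable borel"
    by measurable
  have "duhamel_nn F (t, x)
     = (\<integral>\<^sup>+s. \<integral>\<^sup>+y. ennreal (duhamel_kernel (t, x) (s, y)) * F (s, y) \<partial>lborel \<partial>lborel)"
    unfolding duhamel_nn_def lborel_prod[symmetric]
    by (rule lborel.nn_integral_fst[symmetric]) (rule measurable_lborel_pair, measurable)
  also have "\<dots> = (\<integral>\<^sup>+s. indicator {0<..<t} s * heat_nn (t - s) (\<lambda>y. F (s, y)) x \<partial>lborel)"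
    by (intro nn_integral_cong) (auto simp: duhamel_kernel_def heat_nn_def indicator_def)
  finally show ?thesis .
qed

text \<open>The scale-invariant norm \<open>sup\<^sub>t t\<^sup>\<beta> \<parallel>f(t)\<parallel>\<^sub>q\<close> is at most \<open>m\<close>.\<close>

definition decay_bound :: "real \<Rightarrow> real \<Rightarrow> (real \<times> 'a::euclidean_space \<Rightarrow> ennreal) \<Rightarrow> real \<Rightarrow> bool" where
  "decay_bound q \<beta> f m \<longleftrightarrow>
    (\<forall>t>0. (\<integral>\<^sup>+x. epowr (f (t, x)) q \<partial>lborel) \<le> ennreal ((m * t powr (- \<beta>)) powr q))"

text \<open>This is \<open>heat_nn_Lp_Lq\<close> in the form of a decay rate. It serves twice: for
  the initial value with r = pc, and in \<open>decay_bound_forcing\<close> for w with the exponent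
  l.\<close>

lemma decay_bound_heat_nn:
  fixes f :: "'a::euclidean_space \<Rightarrow> ennreal"
  assumes r: "1 \<le> r" "r \<le> q" and \<beta>: "\<beta> = DIM('a) / 2 * (1 / r - 1 / q)"
    and [measurable]: "f \<in> borel_measurable borel"
    and e: "0 \<le> e" "(\<integral>\<^sup>+x. epowr (f x) r \<partial>lborel) \<le> ennreal (e powr r)"
  shows "decay_bound q \<beta> (\<lambda>z. heat_nn (fst z) f (snd z)) ((4 * pi) powr (- \<beta>) * e)"
  unfolding decay_bound_def
proof (intro allI impI, unfold fst_conv snd_conv)
  fix t :: real assume t: "0 < t"
  have "(\<integral>\<^sup>+x. epowr (heat_nn t f x) q \<partial>lborel)
    \<le> ennreal ((4 * pi * t) powr (- (real DIM('a) / 2 * (q / r - 1))))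
       * epowr (\<integral>\<^sup>+y. epowr (f y) r \<partial>lborel) (q / r)"
    using t r by (rule heat_nn_Lp_Lq) simp
  also have "\<dots> \<le> ennreal ((4 * pi * t) powr (- (real DIM('a) / 2 * (q / r - 1))))
       * epowr (ennreal (e powr r)) (q / r)"
    using e r by (intro mult_left_mono epowr_mono) auto
  also have "\<dots> = ennreal ((4 * pi * t) powr (- (real DIM('a) / 2 * (q / r - 1))) * e powr q)"
    using r by (simp add: epowr_ennreal ennreal_mult powr_powr)
  also have "real DIM('a) / 2 * (q / r - 1) = \<beta> * q"
    using r by (simp add: \<beta> field_simps)
  also have "(4 * pi * t) powr (- (\<beta> * q)) * e powr q = ((4 * pi) powr (- \<beta>) * e * t powr (- \<beta>)) powr q"
    using t e by (simp add: powr_mult powr_powr)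
  finally show "(\<integral>\<^sup>+x. epowr (heat_nn t f x) q \<partial>lborel)
     \<le> ennreal (((4 * pi) powr (- \<beta>) * e * t powr (- \<beta>)) powr q)" .
qed

text \<open>Minkowski's inequality with the weight (t - s)^(-a) s^(-b), of mass at most C t^(1 - a -
  b). Here a is the cost of smoothing and b the decay rate of the source; the relation with \<beta>
  is scale invariance. C is chosen before F and m, so one constant serves all iterates.\<close>

lemma decay_bound_duhamel_nn:
  assumes a: "0 \<le> a" "a < 1" and b: "0 \<le> b" "b < 1" and \<beta>: "1 - a - b = - \<beta>" and q: "1 \<le> q"
  shows "\<exists>C>0. \<forall>F :: real \<times> 'a::euclidean_space \<Rightarrow> ennreal. \<forall>m\<ge>0. F \<in> borel_measurable borel \<longrightarrow>
     (\<forall>t s. 0 < s \<longrightarrow> s < t \<longrightarrow> (\<integral>\<^sup>+x. epowr (heat_nn (t - s) (\<lambda>y. F (s, y)) x) q \<partial>lborel)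
        \<le> ennreal ((m * ((t - s) powr (- a) * s powr (- b))) powr q)) \<longrightarrow>
     decay_bound q \<beta> (duhamel_nn F) (C * m)"
proof -
  obtain C where C: "0 < C" "\<forall>t>0.
      (\<integral>\<^sup>+s. indicator {0<..<t} s * ennreal ((t - s) powr (- a) * s powr (- b)) \<partial>lborel)
      \<le> ennreal (C * t powr (1 - a - b))"
    using nn_integral_time_weight[OF a b] by auto
  show ?thesis
  proof (intro exI[of _ C] conjI allI impI C(1))
    fix F :: "real \<times> 'a \<Rightarrow> ennreal" and m :: real
    assume m: "0 \<le> m" and F[measurable]: "F \<in> borel_measurable borel"
      and *: "\<forall>t s. 0 < s \<longrightarrow> s < t \<longrightarrow> (\<integral>\<^sup>+x. epowr (heat_nn (t - s) (\<lambda>y. F (s, y)) x) q \<partial>lborel)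
        \<le> ennreal ((m * ((t - s) powr (- a) * s powr (- b))) powr q)"
    show "decay_bound q \<beta> (duhamel_nn F) (C * m)"
      unfolding decay_bound_def
    proof (intro allI impI)
      fix t :: real assume t: "0 < t"
      have [measurable]: "F \<in> borel_measurable (borel \<Otimes>\<^sub>M borel)"
        using F by (simp add: borel_prod)
      have [measurable]: "(\<lambda>z. heat_nn (t - fst z) (\<lambda>y. F (fst z, y)) (snd z))
          \<in> borel_measurable (lborel \<Otimes>\<^sub>M lborel)"
        unfolding heat_nn_def by measurable
      have "(\<integral>\<^sup>+x. epowr (duhamel_nn F (t, x)) q \<partial>lborel)
         \<le> ennreal ((m * (C * t powr (1 - a - b))) powr q)"
        unfolding duhamel_nn_iterated[OF F]
        using nn_integral_Minkowski[where M = lborel and N = lborel and A = "{0<..<t}" and q = q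
            and m = m and K = "C * t powr (1 - a - b)"
            and k = "\<lambda>s. (t - s) powr (- a) * s powr (- b)"
            and F = "\<lambda>z. heat_nn (t - fst z) (\<lambda>y. F (fst z, y)) (snd z)"]
          q m t C * by (simp add: lborel.sigma_finite_measure_axioms)
      then show "(\<integral>\<^sup>+x. epowr (duhamel_nn F (t, x)) q \<partial>lborel) \<le> ennreal ((C * m * t powr (- \<beta>)) powr q)"
        by (simp add: \<beta> mult_ac)
    qed
  qed
qed

lemma nn_integral_epowr_le_imp_AE_finite:
  assumes "f \<in> borel_measurable M" "(\<integral>\<^sup>+x. epowr (f x) q \<partial>M) \<le> ennreal c"
  shows "AE x in M. f x < \<top>"
proof -
  have "(\<integral>\<^sup>+x. epowr (f x) q \<partial>M) \<noteq> \<infinity>" using assms(2) by (auto simp: top_unique)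
  then have "AE x in M. epowr (f x) q \<noteq> \<infinity>"
    using assms(1) by (intro nn_integral_PInf_AE) auto
  then show ?thesis by eventually_elim (auto simp: epowr_def less_top split: if_splits)
qed

lemma measurable_heat_nn_joint:
  fixes f :: "'a::euclidean_space \<Rightarrow> ennreal"
  assumes [measurable]: "f \<in> borel_measurable borel"
  shows "(\<lambda>z. heat_nn (fst z) f (snd z)) \<in> borel_measurable borel"
proof -
  have "(\<lambda>z. heat_nn (fst z) f (snd z)) \<in> borel_measurable (borel \<Otimes>\<^sub>M borel)"
    unfolding heat_nn_def by measurable
  then show ?thesis by (simp add: borel_prod)
qed

text \<open>The share M / 9 beats the factor of \<open>epowr_add3_le\<close>: 3^q * 3 * (M / 9)^q =
  3 * (1 / 3)^q * M^q, which is at most M^q because q \<ge> 1.\<close>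

lemma decay_bound_add3:
  fixes f g h :: "real \<times> 'a::euclidean_space \<Rightarrow> ennreal"
  assumes q: "1 \<le> q" and M: "0 \<le> M"
    and [measurable]: "f \<in> borel_measurable borel" "g \<in> borel_measurable borel" "h \<in> borel_measurable borel"
    and f: "decay_bound q \<beta> f m1" and g: "decay_bound q \<beta> g m2" and h: "decay_bound q \<beta> h m3"
    and m: "0 \<le> m1" "m1 \<le> M / 9" "0 \<le> m2" "m2 \<le> M / 9" "0 \<le> m3" "m3 \<le> M / 9"
  shows "decay_bound q \<beta> (\<lambda>z. f z + g z + h z) M"
  unfolding decay_bound_def
proof (intro allI impI)
  fix t :: real assume t: "0 < t"
  let ?d = "t powr (- \<beta>)"
  have [measurable]: "(\<lambda>x. k (t, x)) \<in> borel_measurable borel"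
    if "k \<in> borel_measurable borel" for k :: "real \<times> 'a \<Rightarrow> ennreal"
    using that measurable_compose[OF _ that, of "\<lambda>x. (t, x)" borel]
    by (auto simp: borel_prod[symmetric])
  have le: "(\<integral>\<^sup>+x. epowr (k (t, x)) q \<partial>lborel) \<le> ennreal ((M / 9 * ?d) powr q)"
    if "decay_bound q \<beta> k m" "0 \<le> m" "m \<le> M / 9" for k :: "real \<times> 'a \<Rightarrow> ennreal" and m
  proof -
    have "(\<integral>\<^sup>+x. epowr (k (t, x)) q \<partial>lborel) \<le> ennreal ((m * ?d) powr q)"
      using that t by (simp add: decay_bound_def)
    also have "\<dots> \<le> ennreal ((M / 9 * ?d) powr q)"
      using that q by (intro ennreal_leI powr_mono2 mult_right_mono) auto
    finally show ?thesis .
  qed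
  have "(\<integral>\<^sup>+x. epowr (f (t, x) + g (t, x) + h (t, x)) q \<partial>lborel)
     \<le> (\<integral>\<^sup>+x. ennreal (3 powr q) * (epowr (f (t, x)) q + epowr (g (t, x)) q + epowr (h (t, x)) q) \<partial>lborel)"
    using q by (intro nn_integral_mono epowr_add3_le) auto
  also have "\<dots> = ennreal (3 powr q) * ((\<integral>\<^sup>+x. epowr (f (t, x)) q \<partial>lborel)
      + (\<integral>\<^sup>+x. epowr (g (t, x)) q \<partial>lborel) + (\<integral>\<^sup>+x. epowr (h (t, x)) q \<partial>lborel))"
    by (simp add: nn_integral_cmult nn_integral_add)
  also have "\<dots> \<le> ennreal (3 powr q) * (ennreal ((M / 9 * ?d) powr q)
      + ennreal ((M / 9 * ?d) powr q) + ennreal ((M / 9 * ?d) powr q))"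
    by (intro mult_left_mono add_mono le[OF f] le[OF g] le[OF h] m) auto
  also have "\<dots> = ennreal (3 powr q * (3 * (M / 9 * ?d) powr q))"
    by (simp add: ennreal_mult[symmetric] ennreal_plus[symmetric] del: ennreal_plus)
  also have "3 powr q * (3 * (M / 9 * ?d) powr q) = 3 * (1 / 3) powr q * (M * ?d) powr q"
  proof -
    have "(M / 9 * ?d) powr q = (1 / 9) powr q * (M * ?d) powr q"
      using M by (simp add: powr_mult[symmetric])
    moreover have "3 powr q * (1 / 9) powr q = (1 / 3 :: real) powr q"
      by (simp add: powr_mult[symmetric])
    ultimately show ?thesis by simp
  qed
  also have "ennreal (3 * (1 / 3) powr q * (M * ?d) powr q) \<le> ennreal ((M * ?d) powr q)"
  proof (intro ennreal_leI mult_left_le_one_le)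
    have "(1 / 3 :: real) powr q \<le> (1 / 3) powr 1" using q by (intro powr_mono') auto
    then show "3 * (1 / 3 :: real) powr q \<le> 1" by simp
  qed auto
  finally show "(\<integral>\<^sup>+x. epowr (f (t, x) + g (t, x) + h (t, x)) q \<partial>lborel) \<le> ennreal ((M * ?d) powr q)" .
qed

text \<open>Smoothing w from L^l to L^q costs (t - s)^(-a), and the time factor s^\<sigma> plays the
  role of s^(-b) with b = -\<sigma>. Integrability at s = 0 is the condition \<sigma> > -1.\<close>

lemma decay_bound_forcing:
  fixes \<sigma> \<beta> q l :: real
  defines "a \<equiv> DIM('a) / 2 * (1 / l - 1 / q)"
  assumes l: "1 \<le> l" "l \<le> q" and a: "a < 1" and \<sigma>: "- 1 < \<sigma>" "\<sigma> \<le> 0" and \<beta>: "1 - a + \<sigma> = - \<beta>"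
  shows "\<exists>C>0. \<forall>w :: 'a::euclidean_space \<Rightarrow> ennreal. \<forall>e\<ge>0. w \<in> borel_measurable borel \<longrightarrow>
     (\<integral>\<^sup>+x. epowr (w x) l \<partial>lborel) \<le> ennreal (e powr l) \<longrightarrow>
     decay_bound q \<beta> (duhamel_nn (\<lambda>z. ennreal (fst z powr \<sigma>) * w (snd z))) (C * e)"
proof -
  have a0: "0 \<le> a" unfolding a_def using l by (intro mult_nonneg_nonneg) (auto simp: frac_le)
  have "1 - a - (- \<sigma>) = - \<beta>" using \<beta> by simp
  then obtain C where C: "0 < C" "\<forall>F :: real \<times> 'a \<Rightarrow> ennreal. \<forall>m\<ge>0. F \<in> borel_measurable borel \<longrightarrow>
     (\<forall>t s. 0 < s \<longrightarrow> s < t \<longrightarrow> (\<integral>\<^sup>+x. epowr (heat_nn (t - s) (\<lambda>y. F (s, y)) x) q \<partial>lborel)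
        \<le> ennreal ((m * ((t - s) powr (- a) * s powr (- (- \<sigma>)))) powr q)) \<longrightarrow>
     decay_bound q \<beta> (duhamel_nn F) (C * m)"
    using decay_bound_duhamel_nn[of a "- \<sigma>" \<beta> q, where 'a = 'a] a0 a \<sigma> l by auto
  show ?thesis
  proof (intro exI[of _ "C * (4 * pi) powr (- a)"] conjI allI impI)
    fix w :: "'a \<Rightarrow> ennreal" and e :: real
    assume e: "0 \<le> e" and [measurable]: "w \<in> borel_measurable borel"
      and w: "(\<integral>\<^sup>+x. epowr (w x) l \<partial>lborel) \<le> ennreal (e powr l)"
    define m where "m = (4 * pi) powr (- a) * e"
    let ?F = "\<lambda>z::real \<times> 'a. ennreal (fst z powr \<sigma>) * w (snd z)"
    have m: "0 \<le> m" using e by (simp add: m_def)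
    have F: "?F \<in> borel_measurable borel" unfolding borel_prod[symmetric] by measurable
    have h: "decay_bound q a (\<lambda>z. heat_nn (fst z) w (snd z)) m"
      unfolding m_def by (rule decay_bound_heat_nn[OF l]) (use e w in \<open>auto simp: a_def\<close>)
    have "decay_bound q \<beta> (duhamel_nn ?F) (C * m)"
    proof (rule C(2)[rule_format, OF m F])
      fix t s :: real assume st: "0 < s" "s < t"
      have eq: "heat_nn (t - s) (\<lambda>y. ?F (s, y)) x = ennreal (s powr \<sigma>) * heat_nn (t - s) w x" for x
        unfolding heat_nn_def
        by (subst nn_integral_cmult[symmetric]) (auto simp: mult_ac)
      have "(\<integral>\<^sup>+x. epowr (heat_nn (t - s) (\<lambda>y. ?F (s, y)) x) q \<partial>lborel)
        = epowr (ennreal (s powr \<sigma>)) q * (\<integral>\<^sup>+x. epowr (heat_nn (t - s) w x) q \<partial>lborel)"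
        unfolding eq by (simp add: epowr_mult nn_integral_cmult)
      also have "\<dots> \<le> epowr (ennreal (s powr \<sigma>)) q * ennreal ((m * (t - s) powr (- a)) powr q)"
        using h st by (intro mult_left_mono) (auto simp: decay_bound_def)
      also have "\<dots> = ennreal ((m * ((t - s) powr (- a) * s powr (- (- \<sigma>)))) powr q)"
        using m by (simp add: epowr_ennreal ennreal_mult[symmetric] powr_mult mult_ac)
      finally show "(\<integral>\<^sup>+x. epowr (heat_nn (t - s) (\<lambda>y. ?F (s, y)) x) q \<partial>lborel)
        \<le> ennreal ((m * ((t - s) powr (- a) * s powr (- (- \<sigma>)))) powr q)" .
    qed
    then show "decay_bound q \<beta> (duhamel_nn ?F) (C * (4 * pi) powr (- a) * e)"
      by (simp add: m_def mult.assoc)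
  qed (use C in simp)
qed

definition nonlinearity_nn :: "real \<Rightarrow> real \<Rightarrow> (real \<times> 'a::euclidean_space \<Rightarrow> ennreal) \<Rightarrow> real \<times> 'a \<Rightarrow> ennreal" where
  "nonlinearity_nn \<alpha> p v z = ennreal (norm (snd z) powr \<alpha>) * epowr (v z) p"

lemma measurable_nonlinearity_nn [measurable (raw)]:
  fixes v :: "real \<times> 'a::euclidean_space \<Rightarrow> ennreal"
  assumes [measurable]: "v \<in> borel_measurable borel"
  shows "nonlinearity_nn \<alpha> p v \<in> borel_measurable borel"
proof -
  have [measurable]: "v \<in> borel_measurable (borel \<Otimes>\<^sub>M borel)" using assms by (simp add: borel_prod)
  have "nonlinearity_nn \<alpha> p v \<in> borel_measurable (borel \<Otimes>\<^sub>M borel)"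
    unfolding nonlinearity_nn_def[abs_def] by measurable
  then show ?thesis by (simp add: borel_prod)
qed

text \<open>The time exponent in \<open>heat_nn_weighted_Lq\<close> is -a q, and the decay of v
  contributes s^(-\<beta> p). The conditions a < 1 and \<beta> p < 1 are integrability at s = t and
  at s = 0.\<close>

lemma decay_bound_nonlinearity:
  fixes \<alpha> \<beta> p q :: real
  defines "a \<equiv> DIM('a) * (p - 1) / (2 * q) - \<alpha> / 2"
  assumes \<alpha>: "\<alpha> \<le> 0" and p: "1 < p" "p < q" and q: "DIM('a) * p < q * (DIM('a) + \<alpha>)"
    and a: "a < 1" and \<beta>: "0 \<le> \<beta>" "\<beta> * p < 1" "1 - a - \<beta> * p = - \<beta>"
  shows "\<exists>C>0. \<forall>v :: real \<times> 'a::euclidean_space \<Rightarrow> ennreal. \<forall>m\<ge>0. v \<in> borel_measurable borel \<longrightarrow>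
     decay_bound q \<beta> v m \<longrightarrow> decay_bound q \<beta> (duhamel_nn (nonlinearity_nn \<alpha> p v)) (C * m powr p)"
proof -
  have "0 \<le> DIM('a) * (p - 1) / (2 * q)" using p by simp
  then have a0: "0 \<le> a" unfolding a_def using \<alpha> by linarith
  obtain C where C: "0 < C" "\<forall>F :: real \<times> 'a \<Rightarrow> ennreal. \<forall>m\<ge>0. F \<in> borel_measurable borel \<longrightarrow>
     (\<forall>t s. 0 < s \<longrightarrow> s < t \<longrightarrow> (\<integral>\<^sup>+x. epowr (heat_nn (t - s) (\<lambda>y. F (s, y)) x) q \<partial>lborel)
        \<le> ennreal ((m * ((t - s) powr (- a) * s powr (- (\<beta> * p)))) powr q)) \<longrightarrow>
     decay_bound q \<beta> (duhamel_nn F) (C * m)"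
    using decay_bound_duhamel_nn[of a "\<beta> * p" \<beta> q, where 'a = 'a] a0 a \<beta> p by auto
  obtain D where D: "0 < D" "\<forall>t>0. \<forall>v :: 'a \<Rightarrow> ennreal. v \<in> borel_measurable borel \<longrightarrow>
      (\<integral>\<^sup>+x. epowr (heat_nn t (\<lambda>y. ennreal (norm y powr \<alpha>) * epowr (v y) p) x) q \<partial>lborel)
      \<le> ennreal (D * t powr (\<alpha> * q / 2 - DIM('a) / 2 * (p - 1)))
         * epowr (\<integral>\<^sup>+x. epowr (v x) q \<partial>lborel) p"
    using heat_nn_weighted_Lq[OF \<alpha> p q] by auto
  show ?thesis
  \<comment> \<open>D bounds an integral of q-th powers, so its q-th root enters the norm.\<close>
  proof (intro exI[of _ "C * D powr (1 / q)"] conjI allI impI)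
    fix v :: "real \<times> 'a \<Rightarrow> ennreal" and m :: real
    assume m: "0 \<le> m" and v[measurable]: "v \<in> borel_measurable borel" and vm: "decay_bound q \<beta> v m"
    let ?m = "D powr (1 / q) * m powr p"
    have "decay_bound q \<beta> (duhamel_nn (nonlinearity_nn \<alpha> p v)) (C * ?m)"
    proof (rule C(2)[rule_format])
      fix t s :: real assume st: "0 < s" "s < t"
      have vs: "(\<lambda>y. v (s, y)) \<in> borel_measurable borel"
        using measurable_compose[OF _ v, of "\<lambda>x. (s, x)" borel] by (simp add: borel_prod[symmetric])
      have "(\<integral>\<^sup>+x. epowr (heat_nn (t - s) (\<lambda>y. nonlinearity_nn \<alpha> p v (s, y)) x) q \<partial>lborel)
        \<le> ennreal (D * (t - s) powr (\<alpha> * q / 2 - DIM('a) / 2 * (p - 1)))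
         * epowr (\<integral>\<^sup>+x. epowr (v (s, x)) q \<partial>lborel) p"
        using D(2)[rule_format, OF _ vs, of "t - s"] st by (simp add: nonlinearity_nn_def)
      also have "\<dots> \<le> ennreal (D * (t - s) powr (\<alpha> * q / 2 - DIM('a) / 2 * (p - 1)))
         * epowr (ennreal ((m * s powr (- \<beta>)) powr q)) p"
        using vm st p by (intro mult_left_mono epowr_mono) (auto simp: decay_bound_def)
      also have "\<dots> = ennreal (D * (t - s) powr (\<alpha> * q / 2 - DIM('a) / 2 * (p - 1))
          * (m * s powr (- \<beta>)) powr (q * p))"
        using D(1) by (simp add: epowr_ennreal powr_powr ennreal_mult)
      also have "\<alpha> * q / 2 - DIM('a) / 2 * (p - 1) = - a * q"
        using p by (simp add: a_def field_simps)
      also have "D * (t - s) powr (- a * q) * (m * s powr (- \<beta>)) powr (q * p)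
          = (?m * ((t - s) powr (- a) * s powr (- (\<beta> * p)))) powr q"
        using D(1) m p by (simp add: powr_mult powr_powr mult_ac)
      finally show "(\<integral>\<^sup>+x. epowr (heat_nn (t - s) (\<lambda>y. nonlinearity_nn \<alpha> p v (s, y)) x) q \<partial>lborel)
        \<le> ennreal ((?m * ((t - s) powr (- a) * s powr (- (\<beta> * p)))) powr q)" .
    qed (use D in auto)
    then show "decay_bound q \<beta> (duhamel_nn (nonlinearity_nn \<alpha> p v)) (C * D powr (1 / q) * m powr p)"
      by (simp add: mult.assoc)
  qed (use C D in simp)
qed

section \<open>The nonnegative majorant\<close>

lemma duhamel_nn_mono: "(\<And>z. F z \<le> G z) \<Longrightarrow> duhamel_nn F z \<le> duhamel_nn G z"
  unfolding duhamel_nn_def by (intro nn_integral_mono mult_left_mono) auto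

lemma nonlinearity_nn_mono: "0 \<le> p \<Longrightarrow> v z \<le> v' z \<Longrightarrow> nonlinearity_nn \<alpha> p v z \<le> nonlinearity_nn \<alpha> p v' z"
  unfolding nonlinearity_nn_def by (intro mult_left_mono epowr_mono) auto

text \<open>Continuity along increasing sequences, by monotone convergence; this lets the supremum
  of the iterates in \<open>nonlinear_fixed_point\<close> satisfy the equation.\<close>

lemma duhamel_nn_nonlinearity_SUP:
  fixes V :: "nat \<Rightarrow> real \<times> 'a::euclidean_space \<Rightarrow> ennreal"
  assumes p: "0 < p" and inc: "incseq V" and [measurable]: "\<And>n. V n \<in> borel_measurable borel"
  shows "duhamel_nn (nonlinearity_nn \<alpha> p (\<lambda>z. SUP n. V n z)) z
    = (SUP n. duhamel_nn (nonlinearity_nn \<alpha> p (V n)) z)"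
proof -
  have incz: "incseq (\<lambda>n. V n z)" for z
    by (rule monoI, rule le_funD, erule monoD[OF inc])
  have "duhamel_nn (nonlinearity_nn \<alpha> p (\<lambda>z. SUP n. V n z)) z
     = (\<integral>\<^sup>+z'. (SUP n. ennreal (duhamel_kernel z z') * nonlinearity_nn \<alpha> p (V n) z') \<partial>lborel)"
    unfolding duhamel_nn_def nonlinearity_nn_def
    by (simp add: epowr_SUP[OF p incz] SUP_mult_left_ennreal)
  also have "\<dots> = (SUP n. \<integral>\<^sup>+z'. ennreal (duhamel_kernel z z') * nonlinearity_nn \<alpha> p (V n) z' \<partial>lborel)"
  proof (rule nn_integral_monotone_convergence_SUP)
    show "incseq (\<lambda>n z'. ennreal (duhamel_kernel z z') * nonlinearity_nn \<alpha> p (V n) z')"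
      using p inc by (auto simp: incseq_def le_fun_def intro!: mult_left_mono nonlinearity_nn_mono)
  qed measurable
  finally show ?thesis by (simp add: duhamel_nn_def)
qed

lemma decay_bound_SUP:
  fixes V :: "nat \<Rightarrow> real \<times> 'a::euclidean_space \<Rightarrow> ennreal"
  assumes q: "0 < q" and inc: "incseq V" and V: "\<And>n. V n \<in> borel_measurable borel"
    and b: "\<And>n. decay_bound q \<beta> (V n) M"
  shows "decay_bound q \<beta> (\<lambda>z. SUP n. V n z) M"
  unfolding decay_bound_def
proof (intro allI impI)
  fix t :: real assume t: "0 < t"
  have [measurable]: "(\<lambda>x. V n (t, x)) \<in> borel_measurable borel" for n
    using measurable_compose[OF _ V, of "\<lambda>x. (t, x)" borel] by (simp add: borel_prod[symmetric])
  have incz: "incseq (\<lambda>n. V n z)" for z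
    by (rule monoI, rule le_funD, erule monoD[OF inc])
  have "(\<integral>\<^sup>+x. epowr (SUP n. V n (t, x)) q \<partial>lborel) = (\<integral>\<^sup>+x. (SUP n. epowr (V n (t, x)) q) \<partial>lborel)"
    by (simp add: epowr_SUP[OF q incz])
  also have "\<dots> = (SUP n. \<integral>\<^sup>+x. epowr (V n (t, x)) q \<partial>lborel)"
  proof (rule nn_integral_monotone_convergence_SUP)
    show "incseq (\<lambda>n x. epowr (V n (t, x)) q)"
      using q inc by (auto simp: incseq_def le_fun_def intro!: epowr_mono)
  qed measurable
  also have "\<dots> \<le> ennreal ((M * t powr (- \<beta>)) powr q)"
    using b t by (intro SUP_least) (simp add: decay_bound_def)
  finally show "(\<integral>\<^sup>+x. epowr (SUP n. V n (t, x)) q \<partial>lborel) \<le> ennreal ((M * t powr (- \<beta>)) powr q)" .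
qed

text \<open>Kleene iteration from 0 for a monotone operator that commutes with increasing suprema.
  The equation holds at every point, possibly as \<top> = \<top>; the content lies in the ball
  invariance \<open>step\<close>, which passes to the limit.\<close>

lemma nonlinear_fixed_point:
  fixes A :: "real \<times> 'a::euclidean_space \<Rightarrow> ennreal"
  assumes p: "0 < p" and q: "0 < q" and A[measurable]: "A \<in> borel_measurable borel"
    and step: "\<And>v. v \<in> borel_measurable borel \<Longrightarrow> decay_bound q \<beta> v M \<Longrightarrow>
       decay_bound q \<beta> (\<lambda>z. A z + duhamel_nn (nonlinearity_nn \<alpha> p v) z) M"
  shows "\<exists>V \<in> borel_measurable borel. decay_bound q \<beta> V M \<and>
    (\<forall>z. V z = A z + duhamel_nn (nonlinearity_nn \<alpha> p V) z)"
proof -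
  define T where "T v z = A z + duhamel_nn (nonlinearity_nn \<alpha> p v) z" for v z
  define V where "V n = (T ^^ n) (\<lambda>_. 0)" for n
  have V0: "V 0 = (\<lambda>_. 0)" and VS: "V (Suc n) = T (V n)" for n by (simp_all add: V_def)
  have meas[measurable]: "V n \<in> borel_measurable borel" for n
  proof (induction n)
    case (Suc n)
    note [measurable] = Suc
    show ?case unfolding VS T_def[abs_def] by measurable
  qed (simp add: V0)
  have "V n \<le> V (Suc n)" for n
  proof (induction n)
    case (Suc n)
    then show ?case unfolding VS[of n] VS[of "Suc n"] le_fun_def T_def using p
      by (auto intro!: add_left_mono duhamel_nn_mono nonlinearity_nn_mono)
  qed (simp add: V0 le_fun_def)
  then have inc: "incseq V" by (simp add: incseq_Suc_iff)
  have bnd: "decay_bound q \<beta> (V n) M" for n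
  proof (induction n)
    case (Suc n)
    show ?case using step[OF meas Suc] by (simp add: VS T_def[abs_def])
  qed (simp add: V0 decay_bound_def)
  have incT: "incseq (\<lambda>n. duhamel_nn (nonlinearity_nn \<alpha> p (V n)) z)" for z
    using inc p by (auto simp: incseq_def le_fun_def intro!: duhamel_nn_mono nonlinearity_nn_mono)
  show ?thesis
  proof (intro bexI[of _ "\<lambda>z. SUP n. V n z"] conjI allI)
    show "decay_bound q \<beta> (\<lambda>z. SUP n. V n z) M" by (rule decay_bound_SUP[OF q inc meas bnd])
    fix z
    have "(SUP n. V n z) = (SUP n. V (Suc n) z)"
    proof (rule antisym)
      show "(SUP n. V n z) \<le> (SUP n. V (Suc n) z)"
        using le_funD[OF monoD[OF inc le_SucI[OF order_refl]]] by (intro SUP_mono) blast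
      show "(SUP n. V (Suc n) z) \<le> (SUP n. V n z)" by (rule SUP_mono) blast
    qed
    also have "\<dots> = A z + (SUP n. duhamel_nn (nonlinearity_nn \<alpha> p (V n)) z)"
      unfolding VS T_def using incT by (simp add: ennreal_SUP_add_right)
    finally show "(SUP n. V n z) = A z + duhamel_nn (nonlinearity_nn \<alpha> p (\<lambda>z. SUP n. V n z)) z"
      by (simp add: duhamel_nn_nonlinearity_SUP[OF p inc meas])
  qed measurable
qed

text \<open>The ball of radius M only has to be mapped into itself; no contraction estimate enters.
  Both \<epsilon> and M are fixed before the data.\<close>

lemma majorant_exists:
  fixes \<alpha> \<beta> \<sigma> p q r l :: real
  assumes \<alpha>: "\<alpha> \<le> 0" and p: "1 < p" "p < q" and q: "DIM('a::euclidean_space) * p < q * (DIM('a) + \<alpha>)"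
    and a: "DIM('a) * (p - 1) / (2 * q) - \<alpha> / 2 < 1"
    and \<beta>: "0 \<le> \<beta>" "\<beta> * p < 1" "1 - (DIM('a) * (p - 1) / (2 * q) - \<alpha> / 2) - \<beta> * p = - \<beta>"
    and r: "1 \<le> r" "r \<le> q" "\<beta> = DIM('a) / 2 * (1 / r - 1 / q)"
    and l: "1 \<le> l" "l \<le> q" "DIM('a) / 2 * (1 / l - 1 / q) < 1"
    and \<sigma>: "- 1 < \<sigma>" "\<sigma> \<le> 0" "1 - DIM('a) / 2 * (1 / l - 1 / q) + \<sigma> = - \<beta>"
  shows "\<exists>\<epsilon>>0. \<exists>M. \<forall>f w :: 'a \<Rightarrow> ennreal. f \<in> borel_measurable borel \<longrightarrow> w \<in> borel_measurable borel \<longrightarrow>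
    (\<integral>\<^sup>+x. epowr (f x) r \<partial>lborel) \<le> ennreal (\<epsilon> powr r) \<longrightarrow>
    (\<integral>\<^sup>+x. epowr (w x) l \<partial>lborel) \<le> ennreal (\<epsilon> powr l) \<longrightarrow>
    (\<exists>V \<in> borel_measurable borel. decay_bound q \<beta> V M \<and> (\<forall>z. V z = heat_nn (fst z) f (snd z)
       + duhamel_nn (\<lambda>z'. ennreal (fst z' powr \<sigma>) * w (snd z')) z
       + duhamel_nn (nonlinearity_nn \<alpha> p V) z))"
proof -
  obtain C1 where C1: "0 < C1" "\<forall>w :: 'a \<Rightarrow> ennreal. \<forall>e\<ge>0. w \<in> borel_measurable borel \<longrightarrow>
     (\<integral>\<^sup>+x. epowr (w x) l \<partial>lborel) \<le> ennreal (e powr l) \<longrightarrow>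
     decay_bound q \<beta> (duhamel_nn (\<lambda>z. ennreal (fst z powr \<sigma>) * w (snd z))) (C1 * e)"
    using decay_bound_forcing[OF l \<sigma>] by auto
  obtain C2 where C2: "0 < C2" "\<forall>v :: real \<times> 'a \<Rightarrow> ennreal. \<forall>m\<ge>0. v \<in> borel_measurable borel \<longrightarrow>
     decay_bound q \<beta> v m \<longrightarrow> decay_bound q \<beta> (duhamel_nn (nonlinearity_nn \<alpha> p v)) (C2 * m powr p)"
    using decay_bound_nonlinearity[OF \<alpha> p q a \<beta>] by auto
  define C0 where "C0 = (4 * pi) powr (- \<beta>)"
  have C0: "0 < C0" by (simp add: C0_def)
  \<comment> \<open>The positive solution of C2 M^p = M / 9, which exists since p > 1: the nonlinear
    term uses exactly its share of the ball.\<close>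
  define M where "M = (1 / (9 * C2)) powr (1 / (p - 1))"
  have M: "0 < M" using C2 by (simp add: M_def)
  have M_small: "C2 * M powr p \<le> M / 9"
  proof -
    have "M powr (p - 1) = 1 / (9 * C2)" using C2 p by (simp add: M_def powr_powr)
    then have "M powr p = M * (1 / (9 * C2))" using M powr_add[of M 1 "p - 1"] by simp
    then show ?thesis using C2 by simp
  qed
  \<comment> \<open>Each of the two data terms gets a share M / 9 as well.\<close>
  define \<epsilon> where "\<epsilon> = min (M / (9 * C0)) (M / (9 * C1))"
  have \<epsilon>: "0 < \<epsilon>" "C0 * \<epsilon> \<le> M / 9" "C1 * \<epsilon> \<le> M / 9"
  proof -
    show "0 < \<epsilon>" using M C0 C1 by (simp add: \<epsilon>_def)
    have "\<epsilon> \<le> M / (9 * C0)" "\<epsilon> \<le> M / (9 * C1)" by (simp_all add: \<epsilon>_def)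
    then show "C0 * \<epsilon> \<le> M / 9" "C1 * \<epsilon> \<le> M / 9"
      using C0 C1 by (simp_all add: field_simps)
  qed
  show ?thesis
  proof (rule exI[of _ \<epsilon>], rule conjI[OF \<epsilon>(1)], rule exI[of _ M], intro allI impI)
    fix f w :: "'a \<Rightarrow> ennreal"
    assume f[measurable]: "f \<in> borel_measurable borel" and w[measurable]: "w \<in> borel_measurable borel"
      and f_le: "(\<integral>\<^sup>+x. epowr (f x) r \<partial>lborel) \<le> ennreal (\<epsilon> powr r)"
      and w_le: "(\<integral>\<^sup>+x. epowr (w x) l \<partial>lborel) \<le> ennreal (\<epsilon> powr l)"
    let ?f = "\<lambda>z. heat_nn (fst z) f (snd z)"
    let ?F = "\<lambda>z::real \<times> 'a. ennreal (fst z powr \<sigma>) * w (snd z)"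
    have [measurable]: "?f \<in> borel_measurable borel"
      by (rule measurable_heat_nn_joint) simp
    have "?F \<in> borel_measurable borel" unfolding borel_prod[symmetric] by measurable
    then have [measurable]: "duhamel_nn ?F \<in> borel_measurable borel" by measurable
    have bf: "decay_bound q \<beta> ?f (C0 * \<epsilon>)"
      using decay_bound_heat_nn[OF r f _ f_le] \<epsilon> by (simp add: C0_def)
    have bF: "decay_bound q \<beta> (duhamel_nn ?F) (C1 * \<epsilon>)"
      using C1(2) w w_le \<epsilon>(1) by simp
    have A: "(\<lambda>z. ?f z + duhamel_nn ?F z) \<in> borel_measurable borel" by measurable
    have step: "decay_bound q \<beta> (\<lambda>z. ?f z + duhamel_nn ?F z + duhamel_nn (nonlinearity_nn \<alpha> p v) z) M"
      if [measurable]: "v \<in> borel_measurable borel" and vM: "decay_bound q \<beta> v M" for v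
    proof -
      have bv: "decay_bound q \<beta> (duhamel_nn (nonlinearity_nn \<alpha> p v)) (C2 * M powr p)"
        using C2(2) that M by simp
      show ?thesis
        by (rule decay_bound_add3[OF _ _ _ _ _ bf bF bv])
          (use p M C0 C1 C2 \<epsilon> M_small in auto)
    qed
    show "\<exists>V \<in> borel_measurable borel. decay_bound q \<beta> V M \<and> (\<forall>z. V z = ?f z + duhamel_nn ?F z
       + duhamel_nn (nonlinearity_nn \<alpha> p V) z)"
      using nonlinear_fixed_point[OF _ _ A step] p by simp
  qed
qed

section \<open>The majorant principle\<close>

text \<open>Increments of fixed length d of a convex function grow with the starting point.\<close>

lemma powr_add_diff_mono:
  fixes p x X d :: real
  assumes p: "1 \<le> p" and x: "0 \<le> x" "x \<le> X" and d: "0 \<le> d"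
  shows "(x + d) powr p - x powr p \<le> (X + d) powr p - X powr p"
proof (cases "x = 0")
  case True
  have "d powr p + X powr p = d * d powr (p - 1) + X * X powr (p - 1)"
    using x d True by (simp add: powr_mult_base)
  also have "\<dots> \<le> d * (X + d) powr (p - 1) + X * (X + d) powr (p - 1)"
    using p x d True by (intro add_mono mult_left_mono powr_mono2) auto
  also have "\<dots> = (X + d) powr p" using x d True by (simp add: powr_mult_base add.commute flip: distrib_right)
  finally show ?thesis using True p by simp
next
  case False
  show ?thesis
  proof (rule DERIV_nonneg_imp_nondecreasing[OF x(2), of "\<lambda>x. (x + d) powr p - x powr p"])
    fix y assume y: "x \<le> y"
    then have "0 < y" using False x by linarith
    then have "((\<lambda>x. (x + d) powr p - x powr p) has_real_derivative
        p * (y + d) powr (p - 1) - p * y powr (p - 1)) (at y)"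
      using d by (auto intro!: derivative_eq_intros)
    moreover have "y powr (p - 1) \<le> (y + d) powr (p - 1)"
      using p d \<open>0 < y\<close> by (intro powr_mono2) auto
    then have "0 \<le> p * (y + d) powr (p - 1) - p * y powr (p - 1)"
      using p by (simp add: mult_left_mono)
    ultimately show "\<exists>D. ((\<lambda>x. (x + d) powr p - x powr p) has_real_derivative D) (at y) \<and> 0 \<le> D"
      by blast
  qed
qed

text \<open>By convexity, starting further from 0 and moving further increases the p-th power more.
  This carries the domination of increments through the nonlinearity in
  \<open>majorant_principle\<close>.\<close>

lemma abs_powr_diff_le:
  fixes a c A C p :: real
  assumes p: "1 \<le> p" and c: "\<bar>c\<bar> \<le> C" and ac: "\<bar>a - c\<bar> \<le> A - C"
  shows "\<bar>\<bar>a\<bar> powr p - \<bar>c\<bar> powr p\<bar> \<le> A powr p - C powr p"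
proof -
  have *: "y powr p - x powr p \<le> A powr p - C powr p"
    if "0 \<le> x" "x \<le> y" "x \<le> C" "y - x \<le> A - C" for x y
  proof -
    have "y powr p - x powr p \<le> (C + (y - x)) powr p - C powr p"
      using powr_add_diff_mono[of p x C "y - x"] p that by simp
    also have "(C + (y - x)) powr p \<le> A powr p" using p that by (intro powr_mono2) auto
    finally show ?thesis by simp
  qed
  show ?thesis
  proof (cases "\<bar>c\<bar> \<le> \<bar>a\<bar>")
    case True
    then have "\<bar>c\<bar> powr p \<le> \<bar>a\<bar> powr p" using p by (intro powr_mono2) auto
    moreover have "\<bar>a\<bar> powr p - \<bar>c\<bar> powr p \<le> A powr p - C powr p" using True c ac by (intro *) auto
    ultimately show ?thesis by linarith
  next
    case False
    then have "\<bar>a\<bar> powr p \<le> \<bar>c\<bar> powr p" using p by (intro powr_mono2) auto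
    moreover have "\<bar>c\<bar> powr p - \<bar>a\<bar> powr p \<le> A powr p - C powr p" using False c ac by (intro *) auto
    ultimately show ?thesis by linarith
  qed
qed

text \<open>Kantorovich's majorant principle: the increments of the Picard iterates \<open>u n\<close> are dominated
  by those of the monotone iterates \<open>v n\<close> of the majorant equation, which stay below the
  supersolution \<open>g\<close>.\<close>

lemma majorant_principle:
  fixes k :: "'z \<Rightarrow> 'z \<Rightarrow> real" and b B g :: "'z \<Rightarrow> real"
  assumes "sigma_finite_measure M"
    and k[measurable]: "(\<lambda>(z, z'). k z z') \<in> borel_measurable (M \<Otimes>\<^sub>M M)" and k_nonneg: "\<And>z z'. 0 \<le> k z z'"
    and [measurable]: "b \<in> borel_measurable M" "B \<in> borel_measurable M" "g \<in> borel_measurable M" "S \<in> sets M"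
    and p: "1 \<le> p"
    and bB: "\<And>z. z \<in> S \<Longrightarrow> \<bar>b z\<bar> \<le> B z" and g_nonneg: "\<And>z. 0 \<le> g z"
    and int: "\<And>z. z \<in> S \<Longrightarrow> integrable M (\<lambda>z'. k z z' * g z' powr p)"
    and super: "\<And>z. z \<in> S \<Longrightarrow> B z + (LINT z'|M. k z z' * g z' powr p) \<le> g z"
  shows "\<exists>u \<in> borel_measurable M. \<forall>z\<in>S. integrable M (\<lambda>z'. k z z' * \<bar>u z'\<bar> powr p) \<and>
    u z = b z + (LINT z'|M. k z z' * \<bar>u z'\<bar> powr p)"
proof -
  interpret sigma_finite_measure M by fact
  \<comment> \<open>Off S neither the bound on b nor integrability of the kernel term is available.
    The value 0 there keeps all iterates below g everywhere.\<close>
  define T where "T c f z = (if z \<in> S then c z + (LINT z'|M. k z z' * \<bar>f z'\<bar> powr p) else 0)"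
    for c f :: "'z \<Rightarrow> real" and z
  define u where "u n = (T b ^^ n) (\<lambda>_. 0)" for n
  define v where "v n = (T B ^^ n) (\<lambda>_. 0)" for n
  have u0: "u 0 = (\<lambda>_. 0)" and uS: "\<And>n. u (Suc n) = T b (u n)"
    and v0: "v 0 = (\<lambda>_. 0)" and vS: "\<And>n. v (Suc n) = T B (v n)" by (simp_all add: u_def v_def)
  have uSz: "u (Suc n) z = b z + (LINT z'|M. k z z' * \<bar>u n z'\<bar> powr p)"
    and vSz: "v (Suc n) z = B z + (LINT z'|M. k z z' * \<bar>v n z'\<bar> powr p)" if "z \<in> S" for n z
    using that by (simp_all add: uS vS T_def)
  have T_meas: "T c f \<in> borel_measurable M"
    if [measurable]: "c \<in> borel_measurable M" "f \<in> borel_measurable M" for c f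
    unfolding T_def by measurable
  have u_meas[measurable]: "u n \<in> borel_measurable M" for n
    by (induction n) (auto simp: u0 uS intro!: T_meas)
  have v_meas[measurable]: "v n \<in> borel_measurable M" for n
    by (induction n) (auto simp: v0 vS intro!: T_meas)
  have S_space: "z \<in> space M" if "z \<in> S" for z
    using that sets.sets_into_space[OF \<open>S \<in> sets M\<close>] by auto
  have kz[measurable]: "k z \<in> borel_measurable M" if "z \<in> S" for z
    using measurable_Pair2[OF k S_space[OF that]] by simp
  have integ: "integrable M (\<lambda>z'. k z z' * \<bar>f z'\<bar> powr p)"
    if z: "z \<in> S" and [measurable]: "f \<in> borel_measurable M" and f: "\<And>z'. \<bar>f z'\<bar> \<le> g z'" for f z
  proof (rule Bochner_Integration.integrable_bound[OF int[OF z]])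
    note [measurable] = kz[OF z]
    show "(\<lambda>z'. k z z' * \<bar>f z'\<bar> powr p) \<in> borel_measurable M" by measurable
    show "AE z' in M. norm (k z z' * \<bar>f z'\<bar> powr p) \<le> norm (k z z' * g z' powr p)"
      using p f k_nonneg by (auto simp: abs_mult intro!: mult_left_mono powr_mono2)
  qed
  have B_nonneg: "0 \<le> B z" if "z \<in> S" for z using bB[OF that] by linarith
  \<comment> \<open>Monotonicity and the bound by g go through one induction: the comparison of
    Bochner integrals needs the integrability that g provides.\<close>
  have v_bounds: "0 \<le> v n z \<and> v n z \<le> v (Suc n) z \<and> v (Suc n) z \<le> g z" for n z
  proof (induction n arbitrary: z)
    case 0
    show ?case
    proof (cases "z \<in> S")
      case True
      have "0 \<le> (LINT z'|M. k z z' * g z' powr p)"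
        using k_nonneg by (intro integral_nonneg_AE) auto
      then show ?thesis using super[OF True] B_nonneg[OF True] p by (simp add: vS v0 T_def)
    qed (simp add: vS v0 T_def g_nonneg)
  next
    case (Suc n)
    have v: "0 \<le> v n z" "v n z \<le> v (Suc n) z" "v (Suc n) z \<le> g z" for z using Suc by auto
    have v': "\<bar>v n z\<bar> \<le> g z" "\<bar>v (Suc n) z\<bar> \<le> g z" for z
      using v(1)[of z] v(2)[of z] v(3)[of z] by linarith+
    show ?case
    proof (cases "z \<in> S")
      case z: True
      have "(LINT z'|M. k z z' * \<bar>v n z'\<bar> powr p) \<le> (LINT z'|M. k z z' * \<bar>v (Suc n) z'\<bar> powr p)"
        using v p k_nonneg
        by (intro integral_mono integ z v' v_meas mult_left_mono powr_mono2)
          (auto intro: order_trans[OF v(2) abs_ge_self])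
      moreover have "(LINT z'|M. k z z' * \<bar>v (Suc n) z'\<bar> powr p) \<le> (LINT z'|M. k z z' * g z' powr p)"
        using v' p k_nonneg by (intro integral_mono integ int z v_meas mult_left_mono powr_mono2) auto
      ultimately show ?thesis using super[OF z] v(1,2)[of z] z
        unfolding vS[of n] vS[of "Suc n"] by (simp add: T_def)
    qed (simp add: vS T_def g_nonneg)
  qed
  have v_abs: "\<bar>v n z\<bar> \<le> g z" for n z
    using v_bounds[of n z] by linarith
  have u_bounds: "\<bar>u n z\<bar> \<le> v n z \<and> \<bar>u (Suc n) z - u n z\<bar> \<le> v (Suc n) z - v n z" for n z
  proof (induction n arbitrary: z)
    case 0
    show ?case using bB p by (simp add: u0 v0 uS vS T_def)
  next
    case (Suc n)
    have le: "\<bar>u n z\<bar> \<le> v n z" "\<bar>u (Suc n) z - u n z\<bar> \<le> v (Suc n) z - v n z" for z using Suc by auto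
    have le': "\<bar>u (Suc n) z\<bar> \<le> v (Suc n) z" for z using le[of z] by linarith
    have u_abs: "\<bar>u n z\<bar> \<le> g z" "\<bar>u (Suc n) z\<bar> \<le> g z" for z
      using le[of z] le'[of z] v_bounds[of n z] by linarith+
    show ?case
    proof (cases "z \<in> S")
      case z: True
      note I = integ[OF z v_meas v_abs]
      note J = integ[OF z u_meas[of n] u_abs(1)] integ[OF z u_meas[of "Suc n"] u_abs(2)]
      have "u (Suc (Suc n)) z - u (Suc n) z
         = (LINT z'|M. k z z' * (\<bar>u (Suc n) z'\<bar> powr p - \<bar>u n z'\<bar> powr p))"
        using J by (simp add: uSz[OF z] right_diff_distrib)
      also have "\<bar>\<dots>\<bar> \<le> (LINT z'|M. \<bar>k z z' * (\<bar>u (Suc n) z'\<bar> powr p - \<bar>u n z'\<bar> powr p)\<bar>)"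
        by (rule integral_abs_bound)
      also have "\<dots> \<le> (LINT z'|M. k z z' * (v (Suc n) z' powr p - v n z' powr p))"
      proof (rule integral_mono)
        show "integrable M (\<lambda>z'. \<bar>k z z' * (\<bar>u (Suc n) z'\<bar> powr p - \<bar>u n z'\<bar> powr p)\<bar>)"
          using J by (simp add: right_diff_distrib)
        show "integrable M (\<lambda>z'. k z z' * (v (Suc n) z' powr p - v n z' powr p))"
          using I[of n] I[of "Suc n"] v_bounds by (simp add: right_diff_distrib)
        show "\<bar>k z z' * (\<bar>u (Suc n) z'\<bar> powr p - \<bar>u n z'\<bar> powr p)\<bar>
            \<le> k z z' * (v (Suc n) z' powr p - v n z' powr p)" for z'
          using abs_powr_diff_le[OF p le] k_nonneg by (simp add: abs_mult mult_left_mono)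
      qed
      also have "\<dots> = v (Suc (Suc n)) z - v (Suc n) z"
        using I[of n] I[of "Suc n"] v_bounds by (simp add: vSz[OF z] right_diff_distrib)
      finally show ?thesis using le' by simp
    qed (use le' in \<open>simp add: uS vS T_def\<close>)
  qed
  have u_abs: "\<bar>u n z\<bar> \<le> g z" for n z using u_bounds[of n z] v_abs[of n z] by linarith
  \<comment> \<open>The increments of u telescope against those of v, which is monotone and bounded
    by g; so u inherits the Cauchy property at each point.\<close>
  have conv: "convergent (\<lambda>n. u n z)" for z
  proof -
    have "monoseq (\<lambda>n. v n z)" using v_bounds by (intro incseq_imp_monoseq incseq_SucI) auto
    moreover have "Bseq (\<lambda>n. v n z)" using v_abs by (intro BseqI'[of _ "g z"]) auto
    ultimately have "Cauchy (\<lambda>n. v n z)"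
      using Bseq_monoseq_convergent convergent_Cauchy by blast
    moreover have tele: "\<bar>u m z - u n z\<bar> \<le> v m z - v n z" if "n \<le> m" for m n
      using that
    proof (induction m rule: dec_induct)
      case (step m)
      then show ?case using u_bounds[of m z] by linarith
    qed simp
    have tele': "dist (u m z) (u n z) \<le> dist (v m z) (v n z)" for m n
      using tele[of m n] tele[of n m] by (cases "n \<le> m") (auto simp: dist_real_def)
    ultimately have "Cauchy (\<lambda>n. u n z)"
      unfolding Cauchy_def by (meson le_less_trans)
    then show ?thesis by (simp add: Cauchy_convergent_iff)
  qed
  define w where "w z = lim (\<lambda>n. u n z)" for z
  have lim: "(\<lambda>n. u n z) \<longlonglongrightarrow> w z" for z
    using conv[of z] by (simp add: w_def convergent_LIMSEQ_iff)
  have w_meas[measurable]: "w \<in> borel_measurable M"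
    using u_meas lim by (rule borel_measurable_LIMSEQ_real[rotated])
  have w_abs: "\<bar>w z\<bar> \<le> g z" for z
    by (rule tendsto_upperbound[OF tendsto_rabs[OF lim]]) (auto simp: u_abs)
  show ?thesis
  proof (intro bexI[of _ w] ballI conjI w_meas)
    fix z assume z: "z \<in> S"
    note [measurable] = kz[OF z]
    show "integrable M (\<lambda>z'. k z z' * \<bar>w z'\<bar> powr p)" by (rule integ[OF z w_meas w_abs])
    have "(\<lambda>n. LINT z'|M. k z z' * \<bar>u n z'\<bar> powr p) \<longlonglongrightarrow> (LINT z'|M. k z z' * \<bar>w z'\<bar> powr p)"
    proof (rule integral_dominated_convergence[OF _ _ int[OF z]])
      show "AE z' in M. (\<lambda>n. k z z' * \<bar>u n z'\<bar> powr p) \<longlonglongrightarrow> k z z' * \<bar>w z'\<bar> powr p"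
        using p by (intro AE_I2 tendsto_mult tendsto_const tendsto_powr' tendsto_rabs lim) auto
      show "AE z' in M. norm (k z z' * \<bar>u n z'\<bar> powr p) \<le> k z z' * g z' powr p" for n
        using p u_abs k_nonneg by (auto simp: abs_mult intro!: mult_left_mono powr_mono2)
    qed measurable
    then have "(\<lambda>n. b z + (LINT z'|M. k z z' * \<bar>u n z'\<bar> powr p)) \<longlonglongrightarrow> b z + (LINT z'|M. k z z' * \<bar>w z'\<bar> powr p)"
      by (intro tendsto_add tendsto_const)
    moreover have "(\<lambda>n. u (Suc n) z) \<longlonglongrightarrow> w z" by (rule LIMSEQ_Suc[OF lim])
    ultimately show "w z = b z + (LINT z'|M. k z z' * \<bar>w z'\<bar> powr p)"
      using z by (simp add: uS T_def LIMSEQ_unique)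
  qed
qed

section \<open>Choice of the exponents\<close>

text \<open>In the unknown y = 1 / q every strict condition bounds y from one side, so it suffices
  that an interval is nonempty. The equations between the time exponents hold for every y, by the
  definitions of pc and l.\<close>

lemma exponent_exists:
  fixes N \<alpha> \<sigma> p pc l :: real
  assumes N: "2 \<le> N" and \<alpha>: "- 2 < \<alpha>" "\<alpha> < 0" and \<sigma>: "- 1 < \<sigma>" "\<sigma> < 0"
    and p: "p \<ge> 1 + (2 + \<alpha>) / (N - 2 * (\<sigma> + 1))"
    and pc: "pc = N * (p - 1) / (2 + \<alpha>)" and l: "l = N * pc / (N + 2 * (\<sigma> + 1) * pc)"
  shows "\<exists>q \<beta>. 1 < p \<and> p < q \<and> N * p < q * (N + \<alpha>) \<and> N * (p - 1) / (2 * q) - \<alpha> / 2 < 1 \<and>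
    0 \<le> \<beta> \<and> \<beta> * p < 1 \<and> 1 - (N * (p - 1) / (2 * q) - \<alpha> / 2) - \<beta> * p = - \<beta> \<and>
    1 \<le> pc \<and> pc \<le> q \<and> \<beta> = N / 2 * (1 / pc - 1 / q) \<and>
    1 \<le> l \<and> l \<le> q \<and> N / 2 * (1 / l - 1 / q) < 1 \<and> 1 - N / 2 * (1 / l - 1 / q) + \<sigma> = - \<beta>"
proof -
  define D where "D = N - 2 * (\<sigma> + 1)"
  have D: "0 < D" "D < N" using N \<sigma> by (simp_all add: D_def)
  have "0 < (2 + \<alpha>) / D" using D \<alpha> by simp
  then have p1: "1 < p" using p by (simp add: D_def)
  define c where "c = (2 + \<alpha>) / (N * (p - 1))"
  have c: "0 < c" using N \<alpha> p1 by (simp add: c_def)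
  have c_pc: "1 / pc = c" by (simp add: pc c_def)
  have pc0: "0 < pc" using N \<alpha> p1 by (simp add: pc)
  have Nc: "N * c * (p - 1) = 2 + \<alpha>" using N p1 by (simp add: c_def)
  have "(2 + \<alpha>) / D \<le> p - 1" using p by (simp add: D_def)
  then have "2 + \<alpha> \<le> D * (p - 1)" using D by (simp add: pos_divide_le_eq mult.commute)
  moreover have "N * c = (2 + \<alpha>) / (p - 1)" using N by (simp add: c_def)
  \<comment> \<open>This is the assumption on p in the form 1 / l \<le> 1; it also decides that the
    interval for y is nonempty.\<close>
  ultimately have NcD: "N * c \<le> D" using p1 by (simp add: pos_divide_le_eq)
  have l_inv: "1 / l = c + 2 * (\<sigma> + 1) / N"
    using N pc0 c_pc by (simp add: l add_divide_distrib)
  have l0: "0 < l" using N pc0 \<sigma> by (simp add: l add_pos_nonneg)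
  have l_inv_le: "1 / l \<le> 1" using NcD N by (simp add: l_inv D_def field_simps)
  have Ncp: "N * c * p = 2 + \<alpha> + N * c" using Nc by (simp add: algebra_simps)
  \<comment> \<open>The strict inequality comes from \<sigma> < 0, so the borderline case l = 1 is
    covered.\<close>
  have ub: "c + 2 * \<sigma> / N < (N + \<alpha>) / (N * p)"
  proof -
    have "N * c * p + 2 * \<sigma> * p \<le> N + \<alpha> + 2 * \<sigma> * (p - 1)"
      unfolding Ncp using NcD by (simp add: D_def algebra_simps)
    also have "\<dots> < N + \<alpha>" using \<sigma> p1 by (simp add: mult_neg_pos)
    also have "N * c * p + 2 * \<sigma> * p = (c + 2 * \<sigma> / N) * (N * p)"
      using N by (simp add: distrib_right)
    finally show ?thesis using N p1 by (simp add: pos_less_divide_eq)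
  qed
  have ub': "c - 2 / (N * p) < (N + \<alpha>) / (N * p)"
  proof -
    have "N * c * p < N + \<alpha> + 2" unfolding Ncp using NcD D by linarith
    then have "(c - 2 / (N * p)) * (N * p) < N + \<alpha>"
      using N p1 by (simp add: left_diff_distrib algebra_simps)
    then show ?thesis using N p1 by (simp add: pos_less_divide_eq)
  qed
  \<comment> \<open>The lower bounds c + 2 \<sigma> / N and c - 2 / (N p) make the smoothing cost of
    the forcing term and \<beta> p smaller than 1. The upper bound c gives pc < q and a < 1 for the
    nonlinearity; the other one is the integrability condition on the weight, which also forces p <
    q.\<close>
  have "max 0 (max (c + 2 * \<sigma> / N) (c - 2 / (N * p))) < min c ((N + \<alpha>) / (N * p))"
    using c ub ub' N \<alpha> \<sigma> p1 by (simp add: divide_neg_pos)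
  then obtain y where "max 0 (max (c + 2 * \<sigma> / N) (c - 2 / (N * p))) < y" "y < min c ((N + \<alpha>) / (N * p))"
    using dense by blast
  then have y: "0 < y" "c + 2 * \<sigma> / N < y" "c - 2 / (N * p) < y" "y < c" "y < (N + \<alpha>) / (N * p)"
    by simp_all
  define q where "q = 1 / y"
  have q0: "0 < q" and q_inv: "1 / q = y" using y by (simp_all add: q_def)
  define \<beta> where "\<beta> = N / 2 * (c - y)"
  have 1: "N * p < q * (N + \<alpha>)"
    using y N p1 by (simp add: q_def pos_less_divide_eq mult_ac)
  have 2: "p < q"
  proof -
    have "N * p < q * N" using 1 mult_left_mono[of "N + \<alpha>" N q] q0 \<alpha> by linarith
    then show ?thesis using N by (simp add: mult.commute)
  qed
  have e: "N * (p - 1) / (2 * q) = N * (p - 1) * y / 2" by (simp add: q_def)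
  have 3: "N * (p - 1) / (2 * q) - \<alpha> / 2 < 1"
  proof -
    have "N * (p - 1) * y < N * (p - 1) * c" using y N p1 by (intro mult_strict_left_mono) auto
    then show ?thesis unfolding e using Nc by (simp add: mult_ac)
  qed
  have 4: "0 \<le> \<beta>" using N y by (simp add: \<beta>_def)
  have 5: "\<beta> * p < 1"
  proof -
    have "c - y < 2 / (N * p)" using y by simp
    then show ?thesis using N p1 by (simp add: \<beta>_def pos_less_divide_eq mult_ac)
  qed
  have 6: "1 - (N * (p - 1) / (2 * q) - \<alpha> / 2) - \<beta> * p = - \<beta>"
    unfolding e using Nc by (simp add: \<beta>_def field_simps)
  have 7: "1 \<le> pc"
  proof -
    have "c \<le> 1" using NcD D N mult_le_cancel_left_pos[of N c 1] by linarith
    then show ?thesis using pc0 unfolding c_pc[symmetric] by (simp add: pos_divide_le_eq)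
  qed
  have 8: "pc \<le> q"
  proof -
    have "1 / q \<le> 1 / pc" using y by (simp add: q_inv c_pc)
    then show ?thesis using pc0 q0 by (simp add: field_simps)
  qed
  have 9: "1 \<le> l" using l_inv_le l0 by (simp add: field_simps)
  have 10: "l \<le> q"
  proof -
    have "0 < 2 * (\<sigma> + 1) / N" using N \<sigma> by simp
    then have "1 / q \<le> 1 / l" unfolding q_inv l_inv using y by linarith
    then show ?thesis using l0 q0 by (simp add: field_simps)
  qed
  have e2: "N / 2 * (1 / l - 1 / q) = \<beta> + \<sigma> + 1"
    using N unfolding q_inv l_inv by (simp add: \<beta>_def field_simps)
  have "N * (c - y) < - 2 * \<sigma>" using y N by (simp add: field_simps)
  then have 11: "N / 2 * (1 / l - 1 / q) < 1" unfolding e2 by (simp add: \<beta>_def)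
  show ?thesis
    by (rule exI[of _ q], rule exI[of _ \<beta>], intro conjI p1 1 2 3 4 5 6 7 8 9 10 11)
      (simp add: c_pc q_inv \<beta>_def, unfold e2, simp)
qed

section \<open>From the majorant to a solution\<close>

lemma heat_cong_AE:
  fixes f g :: "'a::euclidean_space \<Rightarrow> real"
  assumes "f \<in> borel_measurable lebesgue" "g \<in> borel_measurable lebesgue" "AE y in lebesgue. f y = g y"
  shows "heat t f x = heat t g x" "heat_converges t f x \<longleftrightarrow> heat_converges t g x"
proof -
  have "(\<lambda>y. heat_kernel t (x - y)) \<in> borel_measurable lborel" by measurable
  then have [measurable]: "(\<lambda>y. heat_kernel t (x - y)) \<in> borel_measurable lebesgue"
    by (rule measurable_completion)
  note [measurable] = assms(1,2)
  have ae: "AE y in lebesgue. heat_kernel t (x - y) * f y = heat_kernel t (x - y) * g y"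
    using assms(3) by eventually_elim simp
  show "heat t f x = heat t g x" unfolding heat_def
    by (rule integral_cong_AE[OF _ _ ae]) measurable
  show "heat_converges t f x \<longleftrightarrow> heat_converges t g x" unfolding heat_converges_def
    by (rule integrable_cong_AE[OF _ _ ae]) measurable
qed

lemma duhamel_cong:
  assumes "\<And>s. 0 < s \<Longrightarrow> s < t \<Longrightarrow> heat (t - s) (F s) x = heat (t - s) (G s) x"
    and "\<And>s. 0 < s \<Longrightarrow> s < t \<Longrightarrow> heat_converges (t - s) (F s) x \<longleftrightarrow> heat_converges (t - s) (G s) x"
  shows "duhamel F t x = duhamel G t x" "duhamel_converges F t x \<longleftrightarrow> duhamel_converges G t x"
proof -
  have eq: "(\<lambda>s. indicator {0<..<t} s *\<^sub>R heat (t - s) (F s) x)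
      = (\<lambda>s. indicator {0<..<t} s *\<^sub>R heat (t - s) (G s) x)"
    using assms(1) by (auto simp: indicator_def)
  show "duhamel F t x = duhamel G t x"
    unfolding duhamel_def set_lebesgue_integral_def eq ..
  show "duhamel_converges F t x \<longleftrightarrow> duhamel_converges G t x"
    using assms(2) unfolding duhamel_converges_def set_integrable_def eq
    by (intro conj_cong AE_cong refl) auto
qed

lemma heat_borel:
  fixes f :: "'a::euclidean_space \<Rightarrow> real"
  assumes [measurable]: "f \<in> borel_measurable borel"
  shows "heat t f x = (LINT y|lborel. heat_kernel t (x - y) * f y)"
    and "heat_converges t f x \<longleftrightarrow> integrable lborel (\<lambda>y. heat_kernel t (x - y) * f y)"
  unfolding heat_def heat_converges_def
  by (intro integral_completion integrable_completion; measurable)+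

text \<open>Fubini's theorem: absolute integrability over space-time yields both halves of
  \<open>duhamel_converges\<close>, namely sections integrable for almost every s and an integrable
  function of s.\<close>

lemma duhamel_eq_integral:
  fixes F :: "real \<times> 'a::euclidean_space \<Rightarrow> real"
  assumes F[measurable]: "F \<in> borel_measurable borel"
    and int: "integrable lborel (\<lambda>z'. duhamel_kernel (t, x) z' * F z')"
  shows "duhamel_converges (\<lambda>s y. F (s, y)) t x"
    and "duhamel (\<lambda>s y. F (s, y)) t x = (LINT z'|lborel. duhamel_kernel (t, x) z' * F z')"
proof -
  define h where "h z' = duhamel_kernel (t, x) z' * F z'" for z'
  define H where "H s = (LINT y|lborel. h (s, y))" for s
  have Fs[measurable]: "(\<lambda>y. F (s, y)) \<in> borel_measurable borel" for s
    using measurable_compose[OF _ F, of "\<lambda>y. (s, y)" borel] by (simp add: borel_prod[symmetric])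
  have h: "integrable (lborel \<Otimes>\<^sub>M lborel) h"
    using int by (simp add: h_def[abs_def] lborel_prod)
  have hs: "h (s, y) = heat_kernel (t - s) (x - y) * F (s, y)" if "0 < s" "s < t" for s y
    using that by (simp add: h_def duhamel_kernel_def)
  have H_eq: "indicator {0<..<t} s *\<^sub>R heat (t - s) (\<lambda>y. F (s, y)) x = H s" for s
    unfolding heat_borel(1)[OF Fs]
    by (auto simp: H_def hs indicator_def) (auto simp: h_def duhamel_kernel_def)
  have H_int: "integrable lborel H"
    unfolding H_def by (rule lborel_pair.integrable_fst'[OF h])
  have "AE s in lborel. integrable lborel (\<lambda>y. h (s, y))"
    by (rule lborel_pair.AE_integrable_fst'[OF h])
  then have "AE s in lborel. s \<in> {0<..<t} \<longrightarrow> heat_converges (t - s) (\<lambda>y. F (s, y)) x"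
    by eventually_elim (auto simp: heat_borel(2)[OF Fs] hs)
  then show "duhamel_converges (\<lambda>s y. F (s, y)) t x"
    using H_int unfolding duhamel_converges_def set_integrable_def H_eq
    by (auto intro!: AE_completion simp: integrable_completion)
  have "duhamel (\<lambda>s y. F (s, y)) t x = (LINT s|lborel. H s)"
    using H_int unfolding duhamel_def set_lebesgue_integral_def H_eq
    by (intro integral_completion) auto
  also have "\<dots> = (LINT z'|(lborel \<Otimes>\<^sub>M lborel). h z')"
    unfolding H_def by (rule lborel_pair.integral_fst'[OF h])
  finally show "duhamel (\<lambda>s y. F (s, y)) t x = (LINT z'|lborel. duhamel_kernel (t, x) z' * F z')"
    by (simp add: h_def[abs_def] lborel_prod)
qed

lemma integrable_nn_integral_abs:
  fixes h :: "'b \<Rightarrow> real"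
  assumes [measurable]: "h \<in> borel_measurable M" and fin: "(\<integral>\<^sup>+x. ennreal \<bar>h x\<bar> \<partial>M) < \<top>"
  shows "integrable M h" "\<bar>LINT x|M. h x\<bar> \<le> enn2real (\<integral>\<^sup>+x. ennreal \<bar>h x\<bar> \<partial>M)"
proof -
  show i: "integrable M h" using fin by (intro integrableI_bounded) auto
  have "ennreal \<bar>LINT x|M. h x\<bar> \<le> (\<integral>\<^sup>+x. ennreal \<bar>h x\<bar> \<partial>M)"
    using integral_norm_bound_ennreal[OF i] by simp
  then show "\<bar>LINT x|M. h x\<bar> \<le> enn2real (\<integral>\<^sup>+x. ennreal \<bar>h x\<bar> \<partial>M)"
    using fin enn2real_mono by fastforce
qed

text \<open>Where V is finite, all three terms of its equation are finite, so the corresponding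
  signed integrals converge absolutely. \<open>majorant_principle\<close> is applied on space-time
  with the weight |x|^\<alpha> absorbed into the kernel.\<close>

lemma global_solution_of_majorant:
  fixes u0 w :: "'a::euclidean_space \<Rightarrow> real" and V :: "real \<times> 'a \<Rightarrow> ennreal"
  assumes u0[measurable]: "u0 \<in> borel_measurable borel" and w[measurable]: "w \<in> borel_measurable borel"
    and V[measurable]: "V \<in> borel_measurable borel" and p: "1 \<le> p"
    and fin: "\<And>t. 0 < t \<Longrightarrow> AE x in lborel. V (t, x) < \<top>"
    and V_eq: "\<And>z. V z = heat_nn (fst z) (\<lambda>y. ennreal \<bar>u0 y\<bar>) (snd z)
       + duhamel_nn (\<lambda>z'. ennreal (fst z' powr \<sigma>) * ennreal \<bar>w (snd z')\<bar>) z
       + duhamel_nn (nonlinearity_nn \<alpha> p V) z"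
  shows "\<exists>u. global_solution \<alpha> p (\<lambda>t. t powr \<sigma>) u0 w u"
proof -
  have [measurable]: "fst \<in> borel_measurable (borel :: (real \<times> 'a) measure)"
    "snd \<in> borel_measurable (borel :: (real \<times> 'a) measure)"
    unfolding borel_prod[symmetric] by measurable
  define F where "F z' = fst z' powr \<sigma> * w (snd z')" for z' :: "real \<times> 'a"
  define k where "k z z' = duhamel_kernel z z' * norm (snd z') powr \<alpha>" for z z' :: "real \<times> 'a"
  define h0 where "h0 z y = heat_kernel (fst z) (snd z - y) * u0 y" for z :: "real \<times> 'a" and y
  define h1 where "h1 z z' = duhamel_kernel z z' * F z'" for z z'
  define A0 where "A0 z = heat_nn (fst z) (\<lambda>y. ennreal \<bar>u0 y\<bar>) (snd z)" for z
  define A1 where "A1 z = duhamel_nn (\<lambda>z'. ennreal (fst z' powr \<sigma>) * ennreal \<bar>w (snd z')\<bar>) z" for z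
  define b where "b z = (LINT y|lborel. h0 z y) + (LINT z'|lborel. h1 z z')" for z
  define S where "S = {z. 0 < fst z \<and> V z < \<top>}"
  \<comment> \<open>Where V is \<top>, g is 0. This only lowers the integral term, and the
    supersolution inequality is required only on S, where V is finite.\<close>
  define g where "g z = enn2real (V z)" for z
  have F_meas[measurable]: "F \<in> borel_measurable borel" unfolding F_def by measurable
  have [measurable]: "A0 \<in> borel_measurable borel"
    unfolding A0_def by (rule measurable_heat_nn_joint) measurable
  have [measurable]: "A1 \<in> borel_measurable borel" unfolding A1_def by measurable
  have [measurable]: "g \<in> borel_measurable borel" unfolding g_def by measurable
  have [measurable]: "(\<lambda>(z, y). h0 z y) \<in> borel_measurable (lborel \<Otimes>\<^sub>M lborel)"
    "(\<lambda>(z, z'). h1 z z') \<in> borel_measurable (lborel \<Otimes>\<^sub>M lborel)"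
    unfolding h0_def h1_def by measurable
  have k_meas: "(\<lambda>(z, z'). k z z') \<in> borel_measurable (lborel \<Otimes>\<^sub>M lborel)"
    unfolding k_def by measurable
  have h0_meas[measurable]: "h0 z \<in> borel_measurable borel" for z unfolding h0_def by measurable
  have h1_meas[measurable]: "h1 z \<in> borel_measurable borel" for z unfolding h1_def by measurable
  have "(\<lambda>z. LINT y|lborel. h0 z y) \<in> borel_measurable lborel" "(\<lambda>z. LINT z'|lborel. h1 z z') \<in> borel_measurable lborel"
    by measurable
  then have b_meas: "b \<in> borel_measurable lborel" unfolding b_def by measurable
  have S_meas: "S \<in> sets lborel"
  proof -
    have "S = {z \<in> space borel. 0 < fst z \<and> V z < \<top>}" by (simp add: S_def)
    also have "\<dots> \<in> sets borel" by measurable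
    finally show ?thesis by simp
  qed
  have V_split: "V z = A0 z + A1 z + duhamel_nn (nonlinearity_nn \<alpha> p V) z" for z
    unfolding A0_def A1_def by (rule V_eq)
  have V_fin: "A0 z < \<top>" "A1 z < \<top>" "duhamel_nn (nonlinearity_nn \<alpha> p V) z < \<top>" if "z \<in> S" for z
    using that V_split[of z] by (auto simp: S_def ennreal_add_less_top)
  have h0_nn: "(\<integral>\<^sup>+y. ennreal \<bar>h0 z y\<bar> \<partial>lborel) = A0 z" for z
    by (simp add: A0_def heat_nn_def h0_def abs_mult ennreal_mult)
  have h1_nn: "(\<integral>\<^sup>+z'. ennreal \<bar>h1 z z'\<bar> \<partial>lborel) = A1 z" for z
    by (simp add: A1_def duhamel_nn_def h1_def F_def abs_mult ennreal_mult mult.assoc)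
  have h0_int: "integrable lborel (h0 z)" "\<bar>LINT y|lborel. h0 z y\<bar> \<le> enn2real (A0 z)" if "z \<in> S" for z
    using integrable_nn_integral_abs[of "h0 z" lborel] V_fin[OF that] by (simp_all add: h0_nn)
  have h1_int: "integrable lborel (h1 z)" "\<bar>LINT z'|lborel. h1 z z'\<bar> \<le> enn2real (A1 z)" if "z \<in> S" for z
    using integrable_nn_integral_abs[of "h1 z" lborel] V_fin[OF that] by (simp_all add: h1_nn)
  have kg_le: "(\<integral>\<^sup>+z'. ennreal (k z z' * g z' powr p) \<partial>lborel) \<le> duhamel_nn (nonlinearity_nn \<alpha> p V) z" for z
    unfolding duhamel_nn_def
  proof (rule nn_integral_mono)
    fix z'
    have "ennreal (g z' powr p) \<le> epowr (V z') p"
      by (cases "V z'") (auto simp: g_def epowr_ennreal)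
    then have "ennreal (k z z') * ennreal (g z' powr p) \<le> ennreal (k z z') * epowr (V z') p"
      by (rule mult_left_mono) simp
    then show "ennreal (k z z' * g z' powr p) \<le> ennreal (duhamel_kernel z z') * nonlinearity_nn \<alpha> p V z'"
      by (simp add: k_def nonlinearity_nn_def ennreal_mult mult.assoc)
  qed
  have kg_meas: "(\<lambda>z'. k z z' * g z' powr p) \<in> borel_measurable lborel" for z
    unfolding k_def by measurable
  have k_nonneg: "0 \<le> k z z'" for z z' by (simp add: k_def)
  have kg_int: "integrable lborel (\<lambda>z'. k z z' * g z' powr p)"
    "(LINT z'|lborel. k z z' * g z' powr p) \<le> enn2real (duhamel_nn (nonlinearity_nn \<alpha> p V) z)"
    if z: "z \<in> S" for z
  proof -
    have abs: "\<bar>k z z' * g z' powr p\<bar> = k z z' * g z' powr p" for z' by (simp add: abs_mult k_nonneg)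
    have fin: "(\<integral>\<^sup>+z'. ennreal \<bar>k z z' * g z' powr p\<bar> \<partial>lborel) < \<top>"
      unfolding abs using kg_le[of z] V_fin(3)[OF z] by (rule le_less_trans)
    show "integrable lborel (\<lambda>z'. k z z' * g z' powr p)"
      by (rule integrable_nn_integral_abs(1)[OF kg_meas fin])
    have "(LINT z'|lborel. k z z' * g z' powr p) \<le> enn2real (\<integral>\<^sup>+z'. ennreal (k z z' * g z' powr p) \<partial>lborel)"
      using integrable_nn_integral_abs(2)[OF kg_meas fin] unfolding abs by linarith
    also have "\<dots> \<le> enn2real (duhamel_nn (nonlinearity_nn \<alpha> p V) z)"
      by (intro enn2real_mono kg_le V_fin z)
    finally show "(LINT z'|lborel. k z z' * g z' powr p) \<le> enn2real (duhamel_nn (nonlinearity_nn \<alpha> p V) z)" .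
  qed
  have "\<exists>u \<in> borel_measurable lborel. \<forall>z\<in>S. integrable lborel (\<lambda>z'. k z z' * \<bar>u z'\<bar> powr p) \<and>
    u z = b z + (LINT z'|lborel. k z z' * \<bar>u z'\<bar> powr p)"
  proof (rule majorant_principle[where B = "\<lambda>z. enn2real (A0 z) + enn2real (A1 z)" and g = g,
        OF lborel.sigma_finite_measure_axioms k_meas k_nonneg b_meas _ _ S_meas p _ _ kg_int(1)])
    fix z assume z: "z \<in> S"
    show "\<bar>b z\<bar> \<le> enn2real (A0 z) + enn2real (A1 z)"
      using h0_int(2)[OF z] h1_int(2)[OF z] unfolding b_def by linarith
    have "enn2real (A0 z) + enn2real (A1 z) + enn2real (duhamel_nn (nonlinearity_nn \<alpha> p V) z) = g z"
      using V_fin[OF z] by (simp add: g_def V_split[of z] enn2real_plus ennreal_add_less_top)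
    then show "enn2real (A0 z) + enn2real (A1 z) + (LINT z'|lborel. k z z' * g z' powr p) \<le> g z"
      using kg_int(2)[OF z] by linarith
  qed (auto simp: g_def)
  then obtain u where u[measurable]: "u \<in> borel_measurable borel"
    and u_int: "\<And>z. z \<in> S \<Longrightarrow> integrable lborel (\<lambda>z'. k z z' * \<bar>u z'\<bar> powr p)"
    and u_eq: "\<And>z. z \<in> S \<Longrightarrow> u z = b z + (LINT z'|lborel. k z z' * \<bar>u z'\<bar> powr p)"
    by auto
  define G where "G z' = norm (snd z') powr \<alpha> * \<bar>u z'\<bar> powr p" for z' :: "real \<times> 'a"
  have G_meas[measurable]: "G \<in> borel_measurable borel" unfolding G_def by measurable
  have kG: "k z z' * \<bar>u z'\<bar> powr p = duhamel_kernel z z' * G z'" for z z'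
    by (simp add: k_def G_def mult.assoc)
  have nonlin: "nonlinearity \<alpha> p (\<lambda>s y. u (s, y)) = (\<lambda>s y. G (s, y))"
    by (intro ext) (simp add: nonlinearity_def G_def)
  have forc: "forcing (\<lambda>t. t powr \<sigma>) w = (\<lambda>s y. F (s, y))"
    by (intro ext) (simp add: forcing_def F_def)
  show ?thesis
  proof (intro exI[of _ "\<lambda>t x. u (t, x)"], unfold global_solution_def nonlin forc, intro conjI allI impI)
    have "u \<in> borel_measurable lebesgue" by (rule measurable_completion) simp
    then show "(\<lambda>(t, x). u (t, x)) \<in> borel_measurable (lebesgue_on ({0<..} \<times> UNIV))"
      by (simp add: measurable_restrict_space1)
    fix t :: real assume t: "0 < t"
    show "AE x in lebesgue. heat_converges t u0 x \<and> duhamel_converges (\<lambda>s y. G (s, y)) t x \<and>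
       duhamel_converges (\<lambda>s y. F (s, y)) t x \<and>
       u (t, x) = heat t u0 x + duhamel (\<lambda>s y. G (s, y)) t x + duhamel (\<lambda>s y. F (s, y)) t x"
    \<comment> \<open>For the fixed t almost every x has (t, x) in S, and the equation holds at
      every point of S; no time has to be excluded.\<close>
    proof (rule AE_completion, use fin[OF t] in eventually_elim)
      case (elim x)
      then have z: "(t, x) \<in> S" using t by (simp add: S_def)
      note 0 = h0_int(1)[OF z, unfolded h0_def, simplified]
      note 1 = duhamel_eq_integral[OF F_meas h1_int(1)[OF z, unfolded h1_def[abs_def]]]
      note 2 = duhamel_eq_integral[OF G_meas u_int[OF z, unfolded kG]]
      show ?case
        using 0 1 2 u_eq[OF z] by (simp add: heat_borel[OF u0] b_def h0_def h1_def kG)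
    qed
  qed
qed

text \<open>Bridges the completion \<open>lebesgue\<close> of the statement and
  \<open>lborel\<close>, on whose products the estimates are carried out.\<close>

lemma in_Lp_borel_representative:
  fixes f :: "'a::euclidean_space \<Rightarrow> real"
  assumes f: "in_Lp q f" and q: "0 < q"
  obtains f' where "f' \<in> borel_measurable borel" "AE x in lebesgue. f x = f' x"
    "(\<integral>\<^sup>+x. epowr (ennreal \<bar>f' x\<bar>) q \<partial>lborel) = ennreal (Lp_norm q f powr q)"
proof -
  have fm: "f \<in> borel_measurable lebesgue" and fi: "integrable lebesgue (\<lambda>x. \<bar>f x\<bar> powr q)"
    using f by (auto simp: in_Lp_def)
  obtain f' where f'[measurable]: "f' \<in> borel_measurable lborel" and ae: "AE x in lborel. f x = f' x"
    using completion_ex_borel_measurable_real[OF fm] by auto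
  have ae': "AE x in lebesgue. f x = f' x" using ae by (rule AE_completion)
  have "(\<integral>\<^sup>+x. epowr (ennreal \<bar>f' x\<bar>) q \<partial>lborel) = (\<integral>\<^sup>+x. ennreal (\<bar>f' x\<bar> powr q) \<partial>lebesgue)"
    by (simp add: epowr_ennreal nn_integral_completion)
  also have "\<dots> = (\<integral>\<^sup>+x. ennreal (\<bar>f x\<bar> powr q) \<partial>lebesgue)"
    using ae' by (intro nn_integral_cong_AE, eventually_elim) simp
  also have "\<dots> = ennreal (LINT x|lebesgue. \<bar>f x\<bar> powr q)"
    using fi by (intro nn_integral_eq_integral) auto
  also have "\<dots> = ennreal (Lp_norm q f powr q)"
    using q by (simp add: Lp_norm_def powr_powr)
  finally show thesis using that[of f'] f' ae' by simp
qed

text \<open>The data enter only through integrals over space, and \<zeta> only at positive times, so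
  the same u solves the equation for data equal almost everywhere.\<close>

lemma global_solution_cong:
  fixes u0 u0' w w' :: "'a::euclidean_space \<Rightarrow> real"
  assumes sol: "global_solution \<alpha> p \<zeta>' u0' w' u" and \<zeta>: "\<And>t. 0 < t \<Longrightarrow> \<zeta> t = \<zeta>' t"
    and m: "u0 \<in> borel_measurable lebesgue" "u0' \<in> borel_measurable lebesgue"
      "w \<in> borel_measurable lebesgue" "w' \<in> borel_measurable lebesgue"
    and ae: "AE x in lebesgue. u0 x = u0' x" "AE x in lebesgue. w x = w' x"
  shows "global_solution \<alpha> p \<zeta> u0 w u"
proof -
  have [measurable]: "forcing \<zeta> w s \<in> borel_measurable lebesgue" "forcing \<zeta>' w' s \<in> borel_measurable lebesgue" for s
    unfolding forcing_def[abs_def] using m by measurable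
  have forc: "AE y in lebesgue. forcing \<zeta> w s y = forcing \<zeta>' w' s y" if "0 < s" for s
    using ae(2) by eventually_elim (simp add: forcing_def \<zeta> that)
  have "duhamel (forcing \<zeta> w) t x = duhamel (forcing \<zeta>' w') t x"
    "duhamel_converges (forcing \<zeta> w) t x \<longleftrightarrow> duhamel_converges (forcing \<zeta>' w') t x" for t x
    by (rule duhamel_cong; intro heat_cong_AE forc; simp)+
  then show ?thesis using sol heat_cong_AE[OF m(1,2) ae(1)] by (simp add: global_solution_def)
qed

theorem theorem1p5:
  fixes \<alpha> \<sigma> p pc l N :: real and \<zeta> :: "real \<Rightarrow> real"
  assumes "N = real CARD('n::finite)" and "CARD('n) \<ge> 2"
    and "-2 < \<alpha>" and "\<alpha> < 0"
    and "-1 < \<sigma>" and "\<sigma> < 0"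
    and "\<And>t. t > 0 \<Longrightarrow> \<zeta> t = t powr \<sigma>"
    and "p \<ge> 1 + (2 + \<alpha>) / (N - 2 * (\<sigma> + 1))"
    and "pc = N * (p - 1) / (2 + \<alpha>)"
    and "l = N * pc / (N + 2 * (\<sigma> + 1) * pc)"
  shows "\<exists>\<epsilon>>0. \<forall>(u0 :: real^'n \<Rightarrow> real) (w :: real^'n \<Rightarrow> real).
           in_Lp pc u0 \<longrightarrow> in_Lp l w \<longrightarrow> Lp_norm pc u0 + Lp_norm l w < \<epsilon> \<longrightarrow>
           (\<exists>u. global_solution \<alpha> p \<zeta> u0 w u)"
proof -
  have N: "2 \<le> N" and N_eq: "N = DIM(real^'n)" using assms(1,2) by simp_all
  obtain q \<beta> where E: "1 < p" "p < q" "N * p < q * (N + \<alpha>)" "N * (p - 1) / (2 * q) - \<alpha> / 2 < 1"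
    "0 \<le> \<beta>" "\<beta> * p < 1" "1 - (N * (p - 1) / (2 * q) - \<alpha> / 2) - \<beta> * p = - \<beta>"
    "1 \<le> pc" "pc \<le> q" "\<beta> = N / 2 * (1 / pc - 1 / q)"
    "1 \<le> l" "l \<le> q" "N / 2 * (1 / l - 1 / q) < 1" "1 - N / 2 * (1 / l - 1 / q) + \<sigma> = - \<beta>"
    using exponent_exists[OF N assms(3-6,8-10)] by blast
  have "\<alpha> \<le> 0" "\<sigma> \<le> 0" using assms by auto
  note ex = majorant_exists[where 'a = "real^'n", folded N_eq, OF \<open>\<alpha> \<le> 0\<close> E(1-13) assms(5) \<open>\<sigma> \<le> 0\<close> E(14)]
  obtain \<epsilon> M where \<epsilon>: "0 < \<epsilon>" and major: "\<forall>f w :: real^'n \<Rightarrow> ennreal.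
    f \<in> borel_measurable borel \<longrightarrow> w \<in> borel_measurable borel \<longrightarrow>
    (\<integral>\<^sup>+x. epowr (f x) pc \<partial>lborel) \<le> ennreal (\<epsilon> powr pc) \<longrightarrow>
    (\<integral>\<^sup>+x. epowr (w x) l \<partial>lborel) \<le> ennreal (\<epsilon> powr l) \<longrightarrow>
    (\<exists>V \<in> borel_measurable borel. decay_bound q \<beta> V M \<and> (\<forall>z. V z = heat_nn (fst z) f (snd z)
       + duhamel_nn (\<lambda>z'. ennreal (fst z' powr \<sigma>) * w (snd z')) z
       + duhamel_nn (nonlinearity_nn \<alpha> p V) z))"
    using ex by (elim exE conjE)
  show ?thesis
  proof (rule exI[of _ \<epsilon>], rule conjI[OF \<epsilon>], intro allI impI)
    fix u0 w :: "real^'n \<Rightarrow> real"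
    assume u0: "in_Lp pc u0" and w: "in_Lp l w" and small: "Lp_norm pc u0 + Lp_norm l w < \<epsilon>"
    have norms: "0 \<le> Lp_norm pc u0" "0 \<le> Lp_norm l w" by (simp_all add: Lp_norm_def)
    obtain f where f[measurable]: "f \<in> borel_measurable borel" and f_ae: "AE x in lebesgue. u0 x = f x"
      and f_norm: "(\<integral>\<^sup>+x. epowr (ennreal \<bar>f x\<bar>) pc \<partial>lborel) = ennreal (Lp_norm pc u0 powr pc)"
      using in_Lp_borel_representative[OF u0] E by auto
    obtain h where h[measurable]: "h \<in> borel_measurable borel" and h_ae: "AE x in lebesgue. w x = h x"
      and h_norm: "(\<integral>\<^sup>+x. epowr (ennreal \<bar>h x\<bar>) l \<partial>lborel) = ennreal (Lp_norm l w powr l)"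
      using in_Lp_borel_representative[OF w] E by auto
    have "(\<integral>\<^sup>+x. epowr (ennreal \<bar>f x\<bar>) pc \<partial>lborel) \<le> ennreal (\<epsilon> powr pc)"
      "(\<integral>\<^sup>+x. epowr (ennreal \<bar>h x\<bar>) l \<partial>lborel) \<le> ennreal (\<epsilon> powr l)"
      unfolding f_norm h_norm using norms small E by (auto intro!: ennreal_leI powr_mono2)
    then obtain V where V[measurable]: "V \<in> borel_measurable borel" and V_bound: "decay_bound q \<beta> V M"
      and V_eq: "\<forall>z. V z = heat_nn (fst z) (\<lambda>x. ennreal \<bar>f x\<bar>) (snd z)
       + duhamel_nn (\<lambda>z'. ennreal (fst z' powr \<sigma>) * ennreal \<bar>h (snd z')\<bar>) z
       + duhamel_nn (nonlinearity_nn \<alpha> p V) z"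
      using major[rule_format, of "\<lambda>x. ennreal \<bar>f x\<bar>" "\<lambda>x. ennreal \<bar>h x\<bar>"] by auto
    have V_fin: "AE x in lborel. V (t, x) < \<top>" if "0 < t" for t
    proof (rule nn_integral_epowr_le_imp_AE_finite)
      show "(\<lambda>x. V (t, x)) \<in> borel_measurable lborel"
        using measurable_compose[OF _ V, of "\<lambda>x. (t, x)" borel] by (simp add: borel_prod[symmetric])
      show "(\<integral>\<^sup>+x. epowr (V (t, x)) q \<partial>lborel) \<le> ennreal ((M * t powr (- \<beta>)) powr q)"
        using V_bound that by (simp add: decay_bound_def)
    qed
    obtain u where "global_solution \<alpha> p (\<lambda>t. t powr \<sigma>) f h u"
      using global_solution_of_majorant[OF f h V _ V_fin V_eq[rule_format]] E(1) by auto
    \<comment> \<open>Return from the Borel representatives f, h to u0, w, and from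
      \<open>t powr \<sigma>\<close> to \<zeta>, which agrees with it for t > 0.\<close>
    then have "global_solution \<alpha> p \<zeta> u0 w u"
      by (rule global_solution_cong)
        (use assms(7) f_ae h_ae u0 w f h in \<open>auto simp: in_Lp_def intro: measurable_completion\<close>)
    then show "\<exists>u. global_solution \<alpha> p \<zeta> u0 w u" by blast
  qed
qed

end
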